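(* Let $f(x)=[1+x(1-x)]R(x)-B(x)$. (1) The function $f$ has the following power series expansions: $$f(x)=\sum_{n=0}^{\infty}a_nx^n=\sum_{n=0}^{\infty}b_n(1-2x)^{2n},\qquad 0<x\leq\tfrac12 .$$ (2) $f$ is strictly decreasing and convex from $(0,1/2]$ onto $[b_0,1)$; $f'$ is strictly increasing and convex from $(0,1/2]$ onto $(a_1,0]$; and the function $F(x)= b_0+b_1(1-2x)^2+B(x)-[1+x(1-x)]R(x)$ is strictly completely monotonic on $(0,1/2]$ with $F(0^+)=b_0+b_1-1=0.0142104\cdots$ and $F(1/2)=0$. Moreover, for each integer $n\ge 2$, the function $F_{1,n}(x)= (-1)^{n+1}f^{(n)}(x)$ is strictly completely monotonic on $(0,1/2]$ with $F_{1,n}(0^+)=(-1)^{n+1}n!\,a_n$, $F_{1,n}(1/2)=0$ if $n$ is odd, and $F_{1,n}(1/2)=-2^n n!\,b_{n/2}$ if $n$ is even. In particular, for $x\in(0,1/2]$, $$\frac{b_0+(1-2x)P(x)+B(x)}{1+x(1-x)}\leq R(x)\leq\frac{b_0+(1-2x)Q(x)+B(x)}{1+x(1-x)},$$ with equality in each instance if and only if $x=1/2$, where $P(x)=\max\{0,\,1-b_0-b_1+b_1(1-2x)\}$ and $Q(x)=\min\{1-b_0,\,b_1(1-2x)\}$.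
   Context: Let $\psi=\Gamma'/\Gamma$ be the digamma function and $\gamma$ the Euler–Mascheroni constant. For $x\in(0,1)$ put $$R(x)=-2\gamma-\psi(x)-\psi(1-x),\qquad B(x)=\Gamma(x)\Gamma(1-x)=\frac{\pi}{\sin(\pi x)}.$$ $\varphi(0^+)$ denotes $\lim_{x\to0^+}\varphi(x)$, and $\varphi^{(0)}$ means $\varphi$ itself. Let $\zeta$ be the Riemann zeta function, $\lambda(n)=\sum_{k=0}^\infty (2k+1)^{-n}$ ($n\ge2$), $\eta(n)=\sum_{k=1}^\infty(-1)^{k-1}k^{-n}$ and $\beta(n)=\sum_{k=0}^\infty(-1)^k(2k+1)^{-n}$ ($n\ge 1$). Constants: $a_0=1$, $a_1=-2\eta(2)-1=-1-\pi^2/6$, $a_2=2\zeta(3)$, and for $n\ge3$, $$a_n=[1+(-1)^n][\zeta(n+1)-\zeta(n-1)]+[1-(-1)^n][\zeta(n)-\eta(n+1)];$$ $b_0=5\log2-\pi$, $b_1=-\log2+[35\zeta(3)-\pi^3]/8$, and $b_n=5\lambda(2n+1)-\lambda(2n-1)-4\beta(2n+1)$ for $n\ge2$. As usual, a smooth function $\varphi$ is strictly completely monotonic on an interval $I$ if $(-1)^m\varphi^{(m)}(x)>0$ for all integers $m\ge0$ and all $x\in I$.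
   Formalization: Strict complete monotonicity is proved on (0,1/2); at x=1/2 it is non-strict, but strict for every order whose derivative is nonzero there (F(1/2)=0 rules out full strictness). For n=2, since F_{1,2}=-f''<0, only the inequalities of order m≥1 are claimed. *)

theory Defs
  imports "HOL-Analysis.Analysis"
begin

definition R_fun :: "real \<Rightarrow> real" where
  "R_fun x = - 2 * euler_mascheroni - Digamma x - Digamma (1 - x)"

definition B_fun :: "real \<Rightarrow> real" where
  "B_fun x = Gamma x * Gamma (1 - x)"

lemma B_fun_altdef: "B_fun x = pi / sin (pi * x)"
proof -
  have "complex_of_real (B_fun x) = Gamma (of_real x) * Gamma (1 - of_real x)"
    unfolding B_fun_def by (simp flip: Gamma_complex_of_real)
  also have "\<dots> = of_real pi / sin (of_real pi * of_real x)"
    by (rule Gamma_reflection_complex)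
  also have "\<dots> = complex_of_real (pi / sin (pi * x))"
    by (simp flip: sin_of_real)
  finally show ?thesis
    by (simp only: of_real_eq_iff)
qed

definition f_fun :: "real \<Rightarrow> real" where
  "f_fun x = (1 + x * (1 - x)) * R_fun x - B_fun x"

text \<open>
  The Dirichlet series at integer arguments.  The values used below are those of
  \<open>zeta\<close>, \<open>lambda\<close> at arguments \<open>\<ge> 2\<close> and of \<open>eta\<close>, \<open>beta\<close> at arguments \<open>\<ge> 1\<close>,
  so that all series in question converge.  Summation starts at \<open>k = 0\<close>, which shifts the
  index of \<open>zeta\<close> and \<open>eta\<close> by one.
\<close>

definition zeta :: "nat \<Rightarrow> real" where
  "zeta n = (\<Sum>k. 1 / real (k + 1) ^ n)"

definition lambda :: "nat \<Rightarrow> real" where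
  "lambda n = (\<Sum>k. 1 / real (2 * k + 1) ^ n)"

definition eta :: "nat \<Rightarrow> real" where
  "eta n = (\<Sum>k. (-1) ^ k / real (k + 1) ^ n)"

definition beta :: "nat \<Rightarrow> real" where
  "beta n = (\<Sum>k. (-1) ^ k / real (2 * k + 1) ^ n)"

definition a_coeff :: "nat \<Rightarrow> real" where
  "a_coeff n =
     (if n = 0 then 1
      else if n = 1 then - 2 * eta 2 - 1
      else if n = 2 then 2 * zeta 3
      else (1 + (-1) ^ n) * (zeta (n + 1) - zeta (n - 1))
         + (1 - (-1) ^ n) * (zeta n - eta (n + 1)))"

definition b_coeff :: "nat \<Rightarrow> real" where
  "b_coeff n =
     (if n = 0 then 5 * ln 2 - pi
      else if n = 1 then - ln 2 + (35 * zeta 3 - pi ^ 3) / 8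
      else 5 * lambda (2 * n + 1) - lambda (2 * n - 1) - 4 * beta (2 * n + 1))"

lemma a_coeff_1: "a_coeff 1 = - 1 - pi\<^sup>2 / 6"
proof -
  have z: "(\<lambda>n. 1 / (real n + 1)\<^sup>2) sums (pi\<^sup>2 / 6)"
    using inverse_squares_sums by (simp add: add_ac)
  have "(\<lambda>n. (1/2) * (1 / (real n + 1)\<^sup>2)) sums ((1/2) * (pi\<^sup>2 / 6))"
    using z by (rule sums_mult)
  moreover have "(1/2) * (1 / (real n + 1)\<^sup>2) = 2 * (1 / (real (2 * n + 1) + 1)\<^sup>2)" for n
  proof -
    have "(real (2 * n + 1) + 1)\<^sup>2 = 4 * (real n + 1)\<^sup>2"
      by (simp add: power2_eq_square algebra_simps)
    then show ?thesis by simp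
  qed
  ultimately have "(\<lambda>n. 2 * (1 / (real (2 * n + 1) + 1)\<^sup>2)) sums (pi\<^sup>2 / 12)"
    by simp
  moreover have "strict_mono (\<lambda>n::nat. 2 * n + 1)"
    by (auto simp: strict_mono_def)
  moreover have "(if odd m then 2 * (1 / (real m + 1)\<^sup>2) else 0) = 0"
    if "m \<notin> range (\<lambda>n::nat. 2 * n + 1)" for m
    using that by (auto simp: image_iff odd_iff_mod_2_eq_one) presburger
  ultimately have "(\<lambda>m. if odd m then 2 * (1 / (real m + 1)\<^sup>2) else 0) sums (pi\<^sup>2 / 12)"
    using sums_mono_reindex[of "\<lambda>n::nat. 2 * n + 1"
        "\<lambda>m. if odd m then 2 * (1 / (real m + 1)\<^sup>2) else 0"] by simp
  from sums_diff[OF z this]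
  have "(\<lambda>m. 1 / (real m + 1)\<^sup>2 - (if odd m then 2 * (1 / (real m + 1)\<^sup>2) else 0))
          sums (pi\<^sup>2 / 12)"
    by simp
  moreover have "(1 / (real m + 1)\<^sup>2 - (if odd m then 2 * (1 / (real m + 1)\<^sup>2) else 0))
      = (-1) ^ m / real (m + 1) ^ 2" for m
    by (simp add: add_ac)
  ultimately have "eta 2 = pi\<^sup>2 / 12"
    unfolding eta_def by (simp add: sums_iff)
  then show ?thesis
    by (simp add: a_coeff_def)
qed

definition F_fun :: "real \<Rightarrow> real" where
  "F_fun x = b_coeff 0 + b_coeff 1 * (1 - 2 * x)\<^sup>2 + B_fun x - (1 + x * (1 - x)) * R_fun x"

text \<open>
  For \<open>n = 2\<close> this is minus the second derivative of the convex function \<open>f_fun\<close>, hence negative;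
  only from \<open>n = 3\<close> on can it be completely monotonic.  For \<open>n = 2\<close> the sign conditions make
  sense for the derivatives of \<open>F1_fun 2\<close> of order at least one.
\<close>

definition F1_fun :: "nat \<Rightarrow> real \<Rightarrow> real" where
  "F1_fun n x = (-1) ^ (n + 1) * (deriv ^^ n) f_fun x"

definition P_fun :: "real \<Rightarrow> real" where
  "P_fun x = max 0 (1 - b_coeff 0 - b_coeff 1 + b_coeff 1 * (1 - 2 * x))"

definition Q_fun :: "real \<Rightarrow> real" where
  "Q_fun x = min (1 - b_coeff 0) (b_coeff 1 * (1 - 2 * x))"

text \<open>
  Derivatives are two-sided, so smoothness on a set that is not open means smoothness on
  an open neighbourhood of it.
\<close>

definition smooth_on :: "(real \<Rightarrow> real) \<Rightarrow> real set \<Rightarrow> bool" where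
  "smooth_on \<phi> I \<longleftrightarrow> (\<exists>U. open U \<and> I \<subseteq> U \<and> (\<forall>m. (deriv ^^ m) \<phi> differentiable_on U))"

definition strictly_completely_monotonic_on :: "(real \<Rightarrow> real) \<Rightarrow> real set \<Rightarrow> bool" where
  "strictly_completely_monotonic_on \<phi> I \<longleftrightarrow>
     smooth_on \<phi> I \<and> (\<forall>m. \<forall>x\<in>I. (-1) ^ m * (deriv ^^ m) \<phi> x > 0)"

definition completely_monotonic_on :: "(real \<Rightarrow> real) \<Rightarrow> real set \<Rightarrow> bool" where
  "completely_monotonic_on \<phi> I \<longleftrightarrow>
     smooth_on \<phi> I \<and> (\<forall>m. \<forall>x\<in>I. (-1) ^ m * (deriv ^^ m) \<phi> x \<ge> 0)"

text \<open>
  Strict complete monotonicity on \<open>{0<..1/2}\<close> cannot hold literally for the functions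
  considered here: \<open>f_fun\<close> is symmetric about \<open>1/2\<close>, so all its derivatives of odd order
  vanish there, and so do \<open>F_fun (1/2)\<close> and the second derivative of \<open>F_fun\<close> at \<open>1/2\<close>.
  The next notion demands the strict inequalities in the interior, the weak ones up to the
  endpoint, and the strict one at \<open>1/2\<close> for those orders \<open>m \<in> M\<close> that are not affected.
\<close>

definition strictly_cm_up_to_half :: "(real \<Rightarrow> real) \<Rightarrow> nat set \<Rightarrow> bool" where
  "strictly_cm_up_to_half \<phi> M \<longleftrightarrow>
     strictly_completely_monotonic_on \<phi> {0<..<1/2} \<and>
     completely_monotonic_on \<phi> {0<..1/2} \<and>
     (\<forall>m\<in>M. (-1) ^ m * (deriv ^^ m) \<phi> (1/2) > 0)"

end

theory Submission
  imports Defs "HOL-Real_Asymp.Real_Asymp"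
begin

text \<open>
  With \<open>y = 1 - 2 * x\<close> and \<open>N = 2 * k + 1\<close>, the partial fractions of the digamma function and of
  \<open>pi / sin (pi * x)\<close> become series in \<open>4 * N / (N\<^sup>2 - y\<^sup>2)\<close>. Expanding these geometrically and
  exchanging the summations yields \<open>f = (\<Sum>n. b n * y ^ (2 * n))\<close>, where for \<open>n \<ge> 2\<close> the coefficient is
  \<open>b n = (\<Sum>k. (5 - N\<^sup>2 - 4 * (-1) ^ k) / N ^ (2 * n + 1)) < 0\<close>. As \<open>y\<close> decreases in \<open>x\<close>,
  negative coefficients give the complete monotonicity of \<open>F\<close> and of the signed derivatives of \<open>f\<close> of
  order at least three. The expansion in powers of \<open>x\<close> supplies the limits at \<open>0\<close>: the second derivative
  of \<open>f\<close> increases from \<open>4 * zeta 3 > 0\<close>, so \<open>f\<close> is convex, and by symmetry its derivative vanishes at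
  \<open>1/2\<close>. The bounds for \<open>R\<close> say that the convex functions \<open>f\<close> and \<open>F\<close> lie below their secants on
  \<open>[0, 1/2]\<close> and above their values at \<open>1/2\<close>.
\<close>

section \<open>Power series and partial fractions\<close>

text \<open>Domination by a product of two summable sequences makes the double family absolutely
  summable over all pairs, so both iterated sums equal its total; \<open>r sums t\<close> says what
  that total is.\<close>

lemma sums_swap_dominated:
  fixes d :: "nat \<Rightarrow> nat \<Rightarrow> real"
  assumes bound: "\<And>k n. \<bar>d k n\<bar> \<le> u k * v n"
    and "summable u" "summable v" "\<And>k. 0 \<le> u k" "\<And>n. 0 \<le> v n"
    and rows: "\<And>k. d k sums r k" and cols: "\<And>n. (\<lambda>k. d k n) sums s n"
    and "r sums t"
  shows "s sums t"
proof -
  have norm_rows: "summable (\<lambda>n. norm (d k n))" for k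
    by (rule summable_comparison_test'[OF summable_mult[OF \<open>summable v\<close>, of "u k"], of 0])
       (use bound in auto)
  have norm_cols: "summable (\<lambda>k. norm (d k n))" for n
    by (rule summable_comparison_test'[OF summable_mult2[OF \<open>summable u\<close>, of "v n"], of 0])
       (use bound in auto)
  have "u summable_on UNIV" "v summable_on UNIV"
    using assms by (auto intro: norm_summable_imp_summable_on)
  then obtain U V where U: "(u has_sum U) UNIV" and V: "(v has_sum V) UNIV"
    by (auto simp: summable_on_def)
  have "(\<lambda>(k, n). u k * v n) summable_on UNIV \<times> UNIV"
  proof (rule summable_on_SigmaI)
    show "((\<lambda>n. (case (k, n) of (k, n) \<Rightarrow> u k * v n)) has_sum u k * V) UNIV" for k
      using has_sum_cmult_right[OF V] by simp
    show "(\<lambda>k. u k * V) summable_on UNIV"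
      using has_sum_cmult_left[OF U] by (auto simp: summable_on_def)
  qed (use assms in auto)
  then have "(\<lambda>x. norm (case x of (k, n) \<Rightarrow> d k n)) summable_on UNIV \<times> UNIV"
    by (rule Infinite_Sum.abs_summable_on_comparison_test') (use bound in auto)
  then have "(\<lambda>(k, n). d k n) summable_on UNIV \<times> UNIV"
    by (rule abs_summable_summable)
  then obtain S where S: "((\<lambda>(k, n). d k n) has_sum S) (UNIV \<times> UNIV)"
    by (auto simp: summable_on_def)
  have "(d k has_sum r k) UNIV" for k
    using norm_rows rows by (rule norm_summable_imp_has_sum)
  then have "(r has_sum S) UNIV"
    using has_sum_SigmaD[OF S] by simp
  then have "r sums S"
    by (rule has_sum_imp_sums)
  with \<open>r sums t\<close> have "S = t"
    using sums_unique2 by blast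
  have "((\<lambda>(n, k). d k n) has_sum S) (UNIV \<times> UNIV)"
    using S by (subst (asm) has_sum_swap) auto
  moreover have "((\<lambda>k. d k n) has_sum s n) UNIV" for n
    using norm_cols cols by (rule norm_summable_imp_has_sum)
  ultimately have "(s has_sum S) UNIV"
    using has_sum_SigmaD[where f = "\<lambda>(n, k). d k n" and S = S and A = UNIV and B = "\<lambda>_. UNIV" and g = s]
    by simp
  then show ?thesis
    using \<open>S = t\<close> has_sum_imp_sums by blast
qed

text \<open>Each fraction is a geometric series in \<open>z\<^sup>2 / p k ^ 2\<close>, and
  \<open>k + 1 \<le> p k\<close> yields a dominating product for exchanging the sums. The freedom in
  \<open>p\<close> covers \<open>k + 1\<close> for expansions about 0 and \<open>2 * k + 1\<close>
  for those about 1/2.\<close>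

lemma sums_partial_fractions:
  fixes c p :: "nat \<Rightarrow> real"
  assumes c: "\<And>k. \<bar>c k\<bar> \<le> 1" and p: "\<And>k. real (k + 1) \<le> p k" and z: "\<bar>z\<bar> < 1"
    and t: "(\<lambda>k. c k / (p k ^ 2 - z ^ 2)) sums t"
  shows "(\<lambda>n. (\<Sum>k. c k / p k ^ (2 * n + 2)) * z ^ (2 * n)) sums t"
proof (rule sums_swap_dominated)
  have p1: "1 \<le> p k" for k
    using p[of k] by simp
  have z2: "z ^ 2 < 1"
    using z by (simp add: abs_square_less_1)
  have u: "summable (\<lambda>k. 1 / real (k + 1) ^ 2)"
    using inverse_squares_sums by (simp add: sums_iff add_ac)
  have bound: "\<bar>c k / p k ^ (2 * n + 2)\<bar> \<le> 1 / real (k + 1) ^ 2" for k n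
  proof -
    have "\<bar>c k / p k ^ (2 * n + 2)\<bar> \<le> 1 / p k ^ (2 * n + 2)"
      using c[of k] p1[of k] by (simp add: abs_div divide_right_mono)
    also have "\<dots> \<le> 1 / real (k + 1) ^ 2"
    proof (rule divide_left_mono)
      have "real (k + 1) ^ 2 \<le> p k ^ 2"
        using p by (intro power_mono) auto
      also have "\<dots> \<le> p k ^ (2 * n + 2)"
        using p1 by (intro power_increasing) auto
      finally show "real (k + 1) ^ 2 \<le> p k ^ (2 * n + 2)" .
      show "0 < p k ^ (2 * n + 2) * real (k + 1) ^ 2"
        using p1[of k] by (intro mult_pos_pos zero_less_power) auto
    qed auto
    finally show ?thesis .
  qed
  show "\<bar>c k / p k ^ (2 * n + 2) * z ^ (2 * n)\<bar> \<le> 1 / real (k + 1) ^ 2 * (z ^ 2) ^ n" for k n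
    unfolding abs_mult by (intro mult_mono bound) (auto simp: power_mult)
  show "summable (\<lambda>n. (z ^ 2) ^ n)"
    using z2 by (intro summable_geometric) auto
  show "summable (\<lambda>k. 1 / real (k + 1) ^ 2)" by (fact u)
  show "(\<lambda>n. c k / p k ^ (2 * n + 2) * z ^ (2 * n)) sums (c k / (p k ^ 2 - z ^ 2))" for k
  proof -
    have "z\<^sup>2 < p k ^ 2"
      using z2 p1[of k] one_le_power[of "p k" 2] by linarith
    then have "z\<^sup>2 / p k ^ 2 < 1"
      using p1[of k] by (subst divide_less_eq_1_pos) (auto intro!: zero_less_power)
    then have "(\<lambda>n. c k / p k ^ 2 * (z\<^sup>2 / p k ^ 2) ^ n) sums (c k / p k ^ 2 * (1 / (1 - z\<^sup>2 / p k ^ 2)))"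
      by (intro sums_mult geometric_sums) auto
    also have "c k / p k ^ 2 * (1 / (1 - z\<^sup>2 / p k ^ 2)) = c k / (p k ^ 2 - z ^ 2)"
      using p1[of k] by (simp add: field_simps)
    also have "(\<lambda>n. c k / p k ^ 2 * (z\<^sup>2 / p k ^ 2) ^ n) = (\<lambda>n. c k / p k ^ (2 * n + 2) * z ^ (2 * n))"
      by (simp add: power_divide power_mult [symmetric] power_add mult_ac fun_eq_iff flip: power2_eq_square)
    finally show ?thesis .
  qed
  have "summable (\<lambda>k. c k / p k ^ (2 * n + 2))" for n
    by (rule summable_comparison_test'[OF u, of 0]) (use bound in auto)
  then show "(\<lambda>k. c k / p k ^ (2 * n + 2) * z ^ (2 * n)) sums ((\<Sum>k. c k / p k ^ (2 * n + 2)) * z ^ (2 * n))" for n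
    by (intro sums_mult2 summable_sums)
qed (use t in auto)

section \<open>Repeated differentiation of power series\<close>

lemma higher_diffs: "(diffs ^^ m) c n = fact (n + m) / fact n * (c (n + m) :: real)"
proof (induction m arbitrary: n)
  case (Suc m)
  have "(diffs ^^ Suc m) c n = real (Suc n) * (diffs ^^ m) c (Suc n)"
    by (simp add: diffs_def)
  also have "\<dots> = fact (n + Suc m) / fact n * c (n + Suc m)"
    by (simp add: Suc field_simps del: of_nat_Suc)
  finally show ?case .
qed simp

text \<open>The affine argument serves both centres: \<open>\<alpha> = 0\<close>,
  \<open>\<beta> = 1\<close> for 0 and \<open>\<alpha> = 1\<close>, \<open>\<beta> = -2\<close> for
  1/2. Each derivative is identified with its series on all of the open set \<open>U\<close>,
  because the next \<open>deriv\<close> depends on a whole neighbourhood.\<close>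

lemma higher_deriv_powser:
  fixes c :: "nat \<Rightarrow> real"
  assumes "open U" and U: "\<And>x. x \<in> U \<Longrightarrow> \<bar>\<alpha> + \<beta> * x\<bar> < r"
    and c: "\<And>z. \<bar>z\<bar> < r \<Longrightarrow> summable (\<lambda>n. c n * z ^ n)"
    and f: "\<And>x. x \<in> U \<Longrightarrow> f x = (\<Sum>n. c n * (\<alpha> + \<beta> * x) ^ n)"
    and "x \<in> U"
  shows "(deriv ^^ m) f x = \<beta> ^ m * (\<Sum>n. (diffs ^^ m) c n * (\<alpha> + \<beta> * x) ^ n)" (is ?th1)
    and "((deriv ^^ m) f has_real_derivative (deriv ^^ Suc m) f x) (at x)" (is ?th2)
    and "\<And>z. \<bar>z\<bar> < r \<Longrightarrow> summable (\<lambda>n. (diffs ^^ m) c n * z ^ n)"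
proof -

  show sm: "summable (\<lambda>n. (diffs ^^ m) c n * z ^ n)" if "\<bar>z\<bar> < r" for z m
    using that
  proof (induction m arbitrary: z)
    case (Suc m)
    have "summable (\<lambda>n. diffs ((diffs ^^ m) c) n * z ^ n)"
      by (rule termdiff_converges[of _ r]) (use Suc in auto)
    then show ?case by simp
  qed (use c in auto)
  have D: "((\<lambda>x. \<beta> ^ m * (\<Sum>n. (diffs ^^ m) c n * (\<alpha> + \<beta> * x) ^ n)) has_real_derivative
           \<beta> ^ Suc m * (\<Sum>n. (diffs ^^ Suc m) c n * (\<alpha> + \<beta> * x) ^ n)) (at x)"
    if xU: "x \<in> U" for x m
  proof -
    obtain K where K: "\<bar>\<alpha> + \<beta> * x\<bar> < K" "K < r"
      using dense[OF U[OF xU]] by blast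
    have "((\<lambda>z. \<Sum>n. (diffs ^^ m) c n * z ^ n) has_real_derivative
           (\<Sum>n. diffs ((diffs ^^ m) c) n * (\<alpha> + \<beta> * x) ^ n)) (at (\<alpha> + \<beta> * x))"
      using K by (intro termdiffs_strong[of _ K] sm) auto
    then have "((\<lambda>x. \<Sum>n. (diffs ^^ m) c n * (\<alpha> + \<beta> * x) ^ n) has_real_derivative
           (\<Sum>n. diffs ((diffs ^^ m) c) n * (\<alpha> + \<beta> * x) ^ n) * \<beta>) (at x)"
      by (rule DERIV_chain2[where g = "\<lambda>x. \<alpha> + \<beta> * x"]) (auto intro!: derivative_eq_intros)
    from DERIV_cmult[OF this, of "\<beta> ^ m"] show ?thesis
      by (simp add: mult_ac)
  qed
  have eq: "\<forall>x\<in>U. (deriv ^^ m) f x = \<beta> ^ m * (\<Sum>n. (diffs ^^ m) c n * (\<alpha> + \<beta> * x) ^ n)" for m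
  proof (induction m)
    case (Suc m)
    show ?case
    proof
      fix x assume "x \<in> U"
      have "((deriv ^^ m) f has_real_derivative
           \<beta> ^ Suc m * (\<Sum>n. (diffs ^^ Suc m) c n * (\<alpha> + \<beta> * x) ^ n)) (at x)"
        by (rule has_field_derivative_transform_within_open[OF D[OF \<open>x \<in> U\<close>, of m] \<open>open U\<close> \<open>x \<in> U\<close>])
           (use Suc in auto)
      then show "(deriv ^^ Suc m) f x = \<beta> ^ Suc m * (\<Sum>n. (diffs ^^ Suc m) c n * (\<alpha> + \<beta> * x) ^ n)"
        by (simp add: DERIV_imp_deriv)
    qed
  qed (use f in auto)
  then show ?th1 using \<open>x \<in> U\<close> by blast
  show ?th2
    unfolding bspec[OF eq \<open>x \<in> U\<close>]
    by (rule has_field_derivative_transform_within_open[OF D[OF \<open>x \<in> U\<close>, of m] \<open>open U\<close> \<open>x \<in> U\<close>])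
       (use eq in auto)
qed

section \<open>Expansions of R, B and f\<close>

lemma sums_Digamma:
  fixes x :: real
  assumes "0 < x"
  shows "(\<lambda>k. 1 / (real k + 1) - 1 / (real k + x)) sums (Digamma x + euler_mascheroni)"
  using summable_sums[OF summable_Digamma[of x]] assms
  by (simp add: Digamma_def inverse_eq_divide add_ac)

text \<open>Both sides come from the derivative of \<open>B_fun\<close>, computed once from the
  product of Gamma values and once from \<open>pi / sin (pi * x)\<close>.\<close>

lemma Digamma_reflection:
  fixes x :: real
  assumes "0 < x" "x < 1"
  shows "Digamma (1 - x) - Digamma x = pi * cot (pi * x)"
proof -
  have notin: "x \<notin> \<int>\<^sub>\<le>\<^sub>0" "1 - x \<notin> \<int>\<^sub>\<le>\<^sub>0"
    using assms by (auto elim!: nonpos_Ints_cases)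
  have sin: "0 < sin (pi * x)"
    using assms by (intro sin_gt_zero) auto
  have "(B_fun has_real_derivative B_fun x * (Digamma x - Digamma (1 - x))) (at x)"
    unfolding B_fun_def [abs_def] using notin
    by (auto intro!: derivative_eq_intros simp: algebra_simps)
  moreover have "(B_fun has_real_derivative - (pi * (cos (pi * x) * pi)) / sin (pi * x) ^ 2) (at x)"
    unfolding B_fun_altdef [abs_def] using sin
    by (auto intro!: derivative_eq_intros simp: power2_eq_square)
  ultimately have "B_fun x * (Digamma x - Digamma (1 - x)) = - (pi * (cos (pi * x) * pi)) / sin (pi * x) ^ 2"
    by (rule DERIV_unique)
  then have "pi * sin (pi * x) * (sin (pi * x) * (Digamma (1 - x) - Digamma x) - pi * cos (pi * x)) = 0"
    using sin by (simp add: B_fun_altdef field_simps power2_eq_square)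
  then have "sin (pi * x) * (Digamma (1 - x) - Digamma x) = pi * cos (pi * x)"
    using sin by simp
  then show ?thesis
    using sin by (simp add: cot_def field_simps)
qed

lemma R_fun_sums:
  assumes "0 < x" "x < 1"
  shows "(\<lambda>k. 1 / (real k + x) + 1 / (real k + 1 - x) - 2 / (real k + 1)) sums R_fun x"
proof -
  have "- (Digamma x + euler_mascheroni + (Digamma (1 - x) + euler_mascheroni)) = R_fun x"
    by (simp add: R_fun_def)
  then show ?thesis
    using sums_minus[OF sums_add[OF sums_Digamma[of x] sums_Digamma[of "1 - x"]]] assms
    by (simp add: algebra_simps)
qed

lemma B_fun_sums:
  assumes "0 < x" "x < 1"
  shows "(\<lambda>k. (-1) ^ k * (1 / (real k + x) + 1 / (real k + 1 - x))) sums B_fun x"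
proof -
  \<comment> \<open>Grouping the terms in pairs gives differences of digamma values, which the reflection
    formula turns into \<open>pi / 2 * (cot (pi * x / 2) + tan (pi * x / 2))\<close>.\<close>
  define t where "t k = 1 / (real k + x) + 1 / (real k + 1 - x)" for k
  \<comment> \<open>Convergence comes first: the value is read off from the grouped series alone,
    and grouping preserves the sum of a series known to converge.\<close>
  have "summable (\<lambda>k. (-1) ^ k * t k)"
  proof (rule summable_Leibniz')
    show "t \<longlonglongrightarrow> 0" unfolding t_def by real_asymp
    show "0 \<le> t k" for k using assms by (simp add: t_def)
    show "t (Suc k) \<le> t k" for k
      unfolding t_def using assms by (intro add_mono frac_le) auto
  qed
  then obtain s where s: "(\<lambda>k. (-1) ^ k * t k) sums s"
    by (auto simp: summable_def)
  have "(\<lambda>n. \<Sum>k = n * 2..<n * 2 + 2. (-1) ^ k * t k) sums s"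
    by (rule sums_group[OF s]) simp
  moreover have "(\<Sum>k = n * 2..<n * 2 + 2. (-1) ^ k * t k) = t (2 * n) - t (2 * n + 1)" for n
    by (simp add: mult.commute)
  ultimately have 1: "(\<lambda>n. t (2 * n) - t (2 * n + 1)) sums s"
    by simp
  \<comment> \<open>At the arguments \<open>(1 + z) / 2\<close> and \<open>z / 2\<close> the terms
    \<open>1 / (k + 1)\<close> of the two digamma series cancel. Below, \<open>z\<close> is
    \<open>x\<close> and \<open>1 - x\<close>.\<close>
  have pair: "(\<lambda>k. 1 / (2 * real k + z) - 1 / (2 * real k + 1 + z))
      sums ((Digamma ((1 + z) / 2) - Digamma (z / 2)) / 2)" if "0 < z" for z :: real
  proof -
    have "(\<lambda>k. ((1 / (real k + 1) - 1 / (real k + (1 + z) / 2)) - (1 / (real k + 1) - 1 / (real k + z / 2))) / 2)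
       sums (((Digamma ((1 + z) / 2) + euler_mascheroni) - (Digamma (z / 2) + euler_mascheroni)) / 2)"
      using that by (intro sums_divide sums_diff sums_Digamma) auto
    moreover have "((1 / (real k + 1) - 1 / (real k + (1 + z) / 2)) - (1 / (real k + 1) - 1 / (real k + z / 2))) / 2
        = 1 / (2 * real k + z) - 1 / (2 * real k + 1 + z)" for k
    proof -
      have "1 / (real k + (1 + z) / 2) = 2 / (2 * real k + 1 + z)" "1 / (real k + z / 2) = 2 / (2 * real k + z)"
        using that by (auto simp: divide_simps)
      then show ?thesis by simp
    qed
    ultimately show ?thesis by (simp add: diff_divide_distrib)
  qed
  have "(\<lambda>k. (1 / (2 * real k + x) - 1 / (2 * real k + 1 + x)) + (1 / (2 * real k + (1 - x)) - 1 / (2 * real k + 1 + (1 - x))))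
     sums ((Digamma ((1 + x) / 2) - Digamma (x / 2)) / 2 + (Digamma ((1 + (1 - x)) / 2) - Digamma ((1 - x) / 2)) / 2)"
    using assms by (intro sums_add pair) auto
  then have "(\<lambda>n. t (2 * n) - t (2 * n + 1)) sums
      ((Digamma (1 - x / 2) - Digamma (x / 2)) / 2 + (Digamma ((1 + x) / 2) - Digamma ((1 - x) / 2)) / 2)"
    by (simp add: t_def algebra_simps diff_divide_distrib add_divide_distrib)
  also have "Digamma (1 - x / 2) - Digamma (x / 2) = pi * cot (pi * (x / 2))"
    using assms by (intro Digamma_reflection) auto
  also have "Digamma ((1 + x) / 2) - Digamma ((1 - x) / 2) = pi * cot (pi * ((1 - x) / 2))"
    using Digamma_reflection[of "(1 - x) / 2"] assms by (simp add: field_simps)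
  also have "pi * cot (pi * (x / 2)) / 2 + pi * cot (pi * ((1 - x) / 2)) / 2 = B_fun x"
  proof -
    \<comment> \<open>The identity is
      \<open>cot u + tan u = 1 / (sin u * cos u) = 2 / sin (2 * u)\<close>.\<close>
    define u where "u = pi * (x / 2)"
    have u: "0 < u" "u < pi / 2"
      using assms by (auto simp: u_def)
    then have nz: "sin u \<noteq> 0" "cos u \<noteq> 0"
      using sin_gt_zero[of u] cos_gt_zero[of u] by auto
    have "pi * ((1 - x) / 2) = pi / 2 - u"
      by (simp add: u_def field_simps)
    then have c: "cot (pi * ((1 - x) / 2)) = sin u / cos u"
      by (simp only: cot_def sin_diff cos_diff) simp
    have "pi * x = 2 * u"
      by (simp add: u_def)
    then have B: "B_fun x = pi / (2 * sin u * cos u)"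
      by (simp add: B_fun_altdef sin_double)
    have "cos u * cos u + sin u * sin u = 1"
      using sin_cos_squared_add[of u] by (simp add: power2_eq_square)
    then show ?thesis
      unfolding c B u_def[symmetric] unfolding cot_def using nz
      by (simp add: divide_simps) (simp add: algebra_simps flip: distrib_left)
  qed
  finally have "s = B_fun x"
    using 1 sums_unique2 by blast
  then show ?thesis
    using s by (simp add: t_def)
qed


section \<open>Operations on series with known sums\<close>

lemma sums_eq_rule:
  "f sums s \<Longrightarrow> (\<And>n. f n = g n) \<Longrightarrow> s = t \<Longrightarrow> g sums t"
  using ext[of f g] by simp

lemma powser_scale:
  fixes a :: "nat \<Rightarrow> real"
  shows "(\<lambda>n. a n * w ^ n) sums s \<Longrightarrow> (\<lambda>n. (e * a n) * w ^ n) sums (e * s)"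
  by (drule sums_mult[of _ _ e]) (simp add: mult_ac)

lemma powser_shift:
  fixes a :: "nat \<Rightarrow> real"
  assumes "(\<lambda>n. a n * w ^ n) sums s"
  shows "(\<lambda>n. (if n = 0 then 0 else a (n - 1)) * w ^ n) sums (w * s)"
proof -
  have "(\<lambda>n. (if Suc n = 0 then 0 else a (Suc n - 1)) * w ^ Suc n) sums (w * s)"
    using sums_mult[OF assms, of w] by (simp add: mult_ac)
  then show ?thesis
    by (subst (asm) sums_Suc_iff) simp
qed

lemma powser_add_const:
  fixes a :: "nat \<Rightarrow> real"
  assumes "(\<lambda>n. a n * w ^ n) sums s"
  shows "(\<lambda>n. (if n = 0 then e + a 0 else a n) * w ^ n) sums (e + s)"
proof -
  have "(\<lambda>n. if n = 0 then e else 0) sums e"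
    using sums_If_finite_set[of "{0::nat}" "\<lambda>_. e"] by simp
  from sums_add[OF this assms] show ?thesis
    by (rule sums_eq_rule) auto
qed

text \<open>Subtracting the value at the centre of expansion leaves terms with a factor
  \<open>z\<^sup>2\<close>. Dividing it out reduces to \<open>sums_partial_fractions\<close>;
  multiplying back shifts the index by one. The case \<open>z = 0\<close>, where division fails, is
  the point 1/2 when \<open>z = 1 - 2 * x\<close>.\<close>

lemma sums_partial_fractions_shifted:
  fixes c p :: "nat \<Rightarrow> real"
  assumes "\<And>k. \<bar>c k\<bar> \<le> 1" "\<And>k. real (k + 1) \<le> p k" "\<bar>z\<bar> < 1"
    and t: "(\<lambda>k. z\<^sup>2 * (c k / (p k ^ 2 - z ^ 2))) sums t"
  shows "(\<lambda>n. (if n = 0 then 0 else \<Sum>k. c k / p k ^ (2 * n)) * (z\<^sup>2) ^ n) sums t"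
proof (cases "z = 0")
  case True
  then have "t = 0" using t sums_unique2[OF t, of 0] by simp
  moreover have "(\<lambda>n. (if n = 0 then 0 else \<Sum>k. c k / p k ^ (2 * n)) * (z\<^sup>2) ^ n) = (\<lambda>n. 0)"
    using True by (auto simp: fun_eq_iff)
  ultimately show ?thesis by simp
next
  case False
  then have "(\<lambda>k. c k / (p k ^ 2 - z ^ 2)) sums (t / z\<^sup>2)"
    using sums_divide[OF t, of "z\<^sup>2"] by simp
  from sums_partial_fractions[OF assms(1-3) this]
  have "(\<lambda>n. (\<Sum>k. c k / p k ^ (2 * n + 2)) * (z\<^sup>2) ^ n) sums (t / z\<^sup>2)"
    by (simp add: power_mult)
  from powser_shift[OF this] show ?thesis
    by (rule sums_eq_rule) (use False in \<open>auto simp: gr0_conv_Suc\<close>)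
qed

section \<open>Expansion about 1/2\<close>

lemma sum_fractions_half:
  fixes x y :: real
  assumes "0 < x" "x < 1" "y = 1 - 2 * x"
  shows "1 / (real k + x) + 1 / (real k + 1 - x) =
    4 * (y\<^sup>2 * (1 / real (2 * k + 1) / (real (2 * k + 1) ^ 2 - y ^ 2))) + 4 / real (2 * k + 1)"
proof -
  define N where "N = real (2 * k + 1)"
  have x: "x = (1 - y) / 2" and y: "\<bar>y\<bar> < 1" and N: "1 \<le> N"
    using assms by (auto simp: N_def)
  have nz: "N - y \<noteq> 0" "N + y \<noteq> 0" "N \<noteq> 0"
    using y N by auto
  have "real k + x = (N - y) / 2" "real k + 1 - x = (N + y) / 2"
    by (simp_all add: N_def x field_simps)
  then have "1 / (real k + x) + 1 / (real k + 1 - x) = 2 / (N - y) + 2 / (N + y)"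
    by (simp only:) simp
  \<comment> \<open>The part \<open>4 / N\<close> does not depend on \<open>y\<close>, so it cancels
    against the series at 1/2; the rest has order \<open>1 / N ^ 3\<close>.\<close>
  also have "\<dots> = 4 * (y\<^sup>2 * (1 / N / ((N - y) * (N + y)))) + 4 / N"
    using nz by (simp add: divide_simps) (simp add: power2_eq_square algebra_simps)
  also have "(N - y) * (N + y) = N\<^sup>2 - y\<^sup>2"
    by (simp add: power2_eq_square algebra_simps)
  finally show ?thesis
    unfolding N_def .
qed

lemma abs_half_range:
  fixes x :: real
  assumes "0 < x" "x < 1"
  shows "\<bar>1 - 2 * x\<bar> < 1"
  using assms by auto

lemma R_fun_half_powser:
  assumes x: "0 < x" "x < 1"
  shows "(\<lambda>n. (if n = 0 then 4 * ln 2 else 4 * lambda (2 * n + 1)) * ((1 - 2 * x)\<^sup>2) ^ n) sums R_fun x"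
proof -
  have R12: "R_fun (1/2) = 4 * ln 2"
    by (simp add: R_fun_def Digamma_one_half)
  \<comment> \<open>Comparing with the series at 1/2 cancels both the parts \<open>4 / N\<close> and
    the terms \<open>2 / (k + 1)\<close>, each of which diverges on its own.\<close>
  have "(\<lambda>k. (1 / (real k + x) + 1 / (real k + 1 - x) - 2 / (real k + 1)) -
     (1 / (real k + 1/2) + 1 / (real k + 1 - 1/2) - 2 / (real k + 1))) sums (R_fun x - R_fun (1/2))"
    using x by (intro sums_diff R_fun_sums) auto
  then have pf: "(\<lambda>k. (1 - 2 * x)\<^sup>2 * (1 / real (2 * k + 1) / (real (2 * k + 1) ^ 2 - (1 - 2 * x) ^ 2))) sums ((R_fun x - 4 * ln 2) / 4)"
    unfolding sum_fractions_half[OF x refl] R12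
    by (subst (asm) sum_fractions_half[of "1/2" 0]) (auto dest: sums_divide[of _ _ 4])
  have "(\<lambda>n. (if n = 0 then 0 else lambda (2 * n + 1)) * ((1 - 2 * x)\<^sup>2) ^ n) sums ((R_fun x - 4 * ln 2) / 4)"
    by (rule sums_eq_rule[OF sums_partial_fractions_shifted[OF _ _ abs_half_range[OF x] pf]])
      (auto simp: lambda_def)
  from powser_add_const[OF powser_scale[OF this, of 4], of "4 * ln 2"] show ?thesis
    by (rule sums_eq_rule) (auto simp: field_simps)
qed

text \<open>Splitting off \<open>B_fun (1/2) = pi\<close> gives the constant coefficient in closed
  form and leaves a double series that converges absolutely.\<close>

lemma B_fun_half_powser_beta:
  assumes x: "0 < x" "x < 1"
  shows "(\<lambda>n. (if n = 0 then pi else 4 * beta (2 * n + 1)) * ((1 - 2 * x)\<^sup>2) ^ n) sums B_fun x"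
proof -
  have B12: "B_fun (1/2) = pi"
    by (simp add: B_fun_altdef)
  have "(\<lambda>k. (-1) ^ k * (1 / (real k + x) + 1 / (real k + 1 - x)) -
     (-1) ^ k * (1 / (real k + 1/2) + 1 / (real k + 1 - 1/2))) sums (B_fun x - B_fun (1/2))"
    using x by (intro sums_diff B_fun_sums) auto
  then have "(\<lambda>k. 4 * ((1 - 2 * x)\<^sup>2 * ((-1) ^ k / real (2 * k + 1) / (real (2 * k + 1) ^ 2 - (1 - 2 * x) ^ 2)))) sums (B_fun x - pi)"
    unfolding sum_fractions_half[OF x refl] B12
    by (subst (asm) sum_fractions_half[of "1/2" 0]) (auto simp: algebra_simps)
  then have pf: "(\<lambda>k. (1 - 2 * x)\<^sup>2 * ((-1) ^ k / real (2 * k + 1) / (real (2 * k + 1) ^ 2 - (1 - 2 * x) ^ 2))) sums ((B_fun x - pi) / 4)"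
    by (auto dest: sums_divide[of _ _ 4])
  have "(\<lambda>n. (if n = 0 then 0 else beta (2 * n + 1)) * ((1 - 2 * x)\<^sup>2) ^ n) sums ((B_fun x - pi) / 4)"
    by (rule sums_eq_rule[OF sums_partial_fractions_shifted[OF _ _ abs_half_range[OF x] pf]])
      (auto simp: beta_def)
  from powser_add_const[OF powser_scale[OF this, of 4], of "pi"] show ?thesis
    by (rule sums_eq_rule) (auto simp: field_simps)
qed

text \<open>At \<open>x = (1 - y) / 2\<close> the function B is
  \<open>pi / cos (pi * y / 2)\<close>. Its coefficient of \<open>y\<^sup>2\<close> is
  \<open>4 * beta 3\<close> by the expansion and \<open>pi ^ 3 / 8\<close> by the Taylor series of
  the cosine; this is the source of \<open>pi ^ 3\<close> in \<open>b_coeff 1\<close>.\<close>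

lemma beta_3: "beta 3 = pi ^ 3 / 32"
proof -
  define h where "h = (\<lambda>w::real. \<Sum>n. 4 * beta (2 * n + 3) * w ^ n)"
  have S: "(\<lambda>n. 4 * beta (2 * n + 3) * (y\<^sup>2) ^ n) sums ((pi / cos (pi * y / 2) - pi) / y\<^sup>2)"
    if y: "0 < y" "y < 1" for y :: real
  proof -
    have "pi * ((1 - y) / 2) = pi / 2 - pi * y / 2"
      by (simp add: field_simps)
    then have B: "B_fun ((1 - y) / 2) = pi / cos (pi * y / 2)"
      unfolding B_fun_altdef by (simp only: sin_diff) simp
    have y': "1 - 2 * ((1 - y) / 2) = y" by (simp add: field_simps)
    have "(\<lambda>n. (if n = 0 then pi else 4 * beta (2 * n + 1)) * (y\<^sup>2) ^ n) sums (pi / cos (pi * y / 2))"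
      using B_fun_half_powser_beta[of "(1 - y) / 2"] y unfolding B y' by simp
    then have "(\<lambda>n. (if Suc n = 0 then pi else 4 * beta (2 * Suc n + 1)) * (y\<^sup>2) ^ Suc n) sums (pi / cos (pi * y / 2) - pi)"
      by (subst sums_Suc_iff) simp
    then have "(\<lambda>n. 4 * beta (2 * n + 3) * (y\<^sup>2) ^ Suc n) sums (pi / cos (pi * y / 2) - pi)"
      by (simp add: numeral_3_eq_3)
    from sums_divide[OF this, of "y\<^sup>2"] y show ?thesis by (simp add: mult.assoc)
  qed
  have "isCont h 0"
    unfolding h_def using sums_summable[OF S[of "1/2"]] by (intro isCont_powser[of _ "(1/2)\<^sup>2"]) auto
  then have "((\<lambda>y. h (y\<^sup>2)) \<longlongrightarrow> h 0) (at_right 0)"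
    by (rule isCont_tendsto_compose) real_asymp
  moreover have "eventually (\<lambda>y. h (y\<^sup>2) = (pi / cos (pi * y / 2) - pi) / y\<^sup>2) (at_right 0)"
    using eventually_at_right_real[of 0 "1::real"]
    by (auto elim!: eventually_mono simp: h_def sums_unique[OF S])
  ultimately have "((\<lambda>y. (pi / cos (pi * y / 2) - pi) / y\<^sup>2) \<longlongrightarrow> h 0) (at_right 0)"
    by (rule Lim_transform_eventually)
  moreover have "((\<lambda>y. (pi / cos (pi * y / 2) - pi) / y\<^sup>2) \<longlongrightarrow> pi ^ 3 / 8) (at_right 0)"
    by (real_asymp simp: power3_eq_cube)
  ultimately have "h 0 = pi ^ 3 / 8"
    using tendsto_unique trivial_limit_at_right_real by blast
  moreover have "h 0 = 4 * beta 3"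
    by (simp add: h_def)
  ultimately show ?thesis by simp
qed

lemma zeta_sums:
  assumes "2 \<le> n"
  shows "(\<lambda>k. 1 / real (k + 1) ^ n) sums zeta n"
proof -
  have u: "summable (\<lambda>k. 1 / real (k + 1) ^ 2)"
    using inverse_squares_sums by (simp add: sums_iff add_ac)
  show ?thesis
    unfolding zeta_def
    by (intro summable_sums summable_comparison_test'[OF u, of 0])
       (use assms in \<open>auto intro!: frac_le power_increasing simp del: of_nat_Suc\<close>)
qed

lemma lambda_sums:
  assumes "2 \<le> n"
  shows "(\<lambda>k. 1 / real (2 * k + 1) ^ n) sums lambda n"
  unfolding lambda_def
  by (intro summable_sums summable_comparison_test'[OF sums_summable[OF zeta_sums[OF assms]], of 0])
     (auto intro!: frac_le power_mono)

lemma beta_sums: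
  assumes "2 \<le> n"
  shows "(\<lambda>k. (-1) ^ k / real (2 * k + 1) ^ n) sums beta n"
  unfolding beta_def
  by (intro summable_sums summable_comparison_test'[OF sums_summable[OF zeta_sums[OF assms]], of 0])
     (auto intro!: frac_le power_mono)

text \<open>Pairing odd and even denominators gives \<open>zeta 3 = lambda 3 + zeta 3 / 8\<close>,
  so the term \<open>5 * lambda 3\<close> becomes \<open>35 * zeta 3 / 8\<close> in
  \<open>b_coeff 1\<close>.\<close>

lemma lambda_3: "lambda 3 = 7 / 8 * zeta 3"
proof -
  have "(\<lambda>n. \<Sum>k = n * 2..<n * 2 + 2. 1 / real (k + 1) ^ 3) sums zeta 3"
    by (rule sums_group[OF zeta_sums]) auto
  moreover have "(\<Sum>k = n * 2..<n * 2 + 2. 1 / real (k + 1) ^ 3) = 1 / real (2 * n + 1) ^ 3 + 1 / 8 * (1 / real (n + 1) ^ 3)" for n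
  proof -
    have "real (n * 2 + 1 + 1) ^ 3 = 8 * real (n + 1) ^ 3"
      by (simp add: power3_eq_cube algebra_simps)
    then show ?thesis
      by (simp add: mult.commute)
  qed
  ultimately have "(\<lambda>n. 1 / real (2 * n + 1) ^ 3 + 1 / 8 * (1 / real (n + 1) ^ 3)) sums zeta 3"
    by simp
  moreover have "(\<lambda>n. 1 / real (2 * n + 1) ^ 3 + 1 / 8 * (1 / real (n + 1) ^ 3)) sums (lambda 3 + 1 / 8 * zeta 3)"
    by (intro sums_add sums_mult lambda_sums zeta_sums) auto
  ultimately have "zeta 3 = lambda 3 + 1 / 8 * zeta 3"
    by (rule sums_unique2)
  then show ?thesis by simp
qed

text \<open>Since \<open>1 + x * (1 - x) = (5 - w) / 4\<close> with
  \<open>w = (1 - 2 * x)\<^sup>2\<close>, each coefficient of R is combined with its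
  predecessor.\<close>

lemma f_fun_half_powser:
  assumes x: "0 < x" "x < 1"
  shows "(\<lambda>n. b_coeff n * (1 - 2 * x) ^ (2 * n)) sums f_fun x"
proof -
  define w where "w = (1 - 2 * x)\<^sup>2"
  let ?r = "\<lambda>n. if n = 0 then 4 * ln 2 else 4 * lambda (2 * n + 1)"
  let ?B = "\<lambda>n. if n = 0 then pi else 4 * beta (2 * n + 1)"
  have R: "(\<lambda>n. ?r n * w ^ n) sums R_fun x" and B: "(\<lambda>n. ?B n * w ^ n) sums B_fun x"
    using R_fun_half_powser[OF x] B_fun_half_powser_beta[OF x] by (simp_all add: w_def)
  have "(\<lambda>n. 5 / 4 * (?r n * w ^ n) - 1 / 4 * ((if n = 0 then 0 else ?r (n - 1)) * w ^ n) - ?B n * w ^ n) sums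
     (5 / 4 * R_fun x - 1 / 4 * (w * R_fun x) - B_fun x)"
    by (intro sums_diff sums_mult powser_shift R B)
  also have "(\<lambda>n. 5 / 4 * (?r n * w ^ n) - 1 / 4 * ((if n = 0 then 0 else ?r (n - 1)) * w ^ n) - ?B n * w ^ n)
    = (\<lambda>n. b_coeff n * (1 - 2 * x) ^ (2 * n))"
  proof
    fix n :: nat
    \<comment> \<open>Index 1 is special because its predecessor is \<open>4 * ln 2\<close>,
      standing where the divergent series for \<open>lambda 1\<close> would.\<close>
    consider "n = 0" | "n = 1" | m where "n = Suc (Suc m)"
      by (metis One_nat_def not0_implies_Suc)
    then have "b_coeff n = 5 / 4 * ?r n - 1 / 4 * (if n = 0 then 0 else ?r (n - 1)) - ?B n"
      by cases (auto simp: b_coeff_def lambda_3 beta_3 numeral_3_eq_3[symmetric] field_simps)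
    moreover have "(1 - 2 * x) ^ (2 * n) = w ^ n"
      by (simp add: w_def power_mult)
    ultimately show "5 / 4 * (?r n * w ^ n) - 1 / 4 * ((if n = 0 then 0 else ?r (n - 1)) * w ^ n) - ?B n * w ^ n
       = b_coeff n * (1 - 2 * x) ^ (2 * n)"
      by (simp only: left_diff_distrib mult.assoc)
  qed
  also have "5 / 4 * R_fun x - 1 / 4 * (w * R_fun x) - B_fun x = f_fun x"
    by (simp add: w_def f_fun_def power2_eq_square algebra_simps)
  finally show ?thesis .
qed

section \<open>Expansion about 0\<close>

lemma R_fun_powser:
  assumes x: "0 < x" "x < 1"
  shows "(\<lambda>n. (if n = 0 then 0 else 2 * zeta (2 * n + 1)) * (x\<^sup>2) ^ n) sums (R_fun x - 1 / x)"
proof -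
  \<comment> \<open>This telescoping series turns \<open>1 / (k + x)\<close> into
    \<open>1 / (k + 1 + x)\<close> and thereby removes the pole \<open>1 / x\<close>.\<close>
  have "(\<lambda>k. 1 / (real k + x) - 1 / (real (Suc k) + x)) sums (1 / (real 0 + x) - 0)"
    by (intro telescope_sums') real_asymp
  from sums_diff[OF R_fun_sums[OF x] this]
  have "(\<lambda>k. 1 / (real k + 1 + x) + 1 / (real k + 1 - x) - 2 / (real k + 1)) sums (R_fun x - 1 / x)"
    by (rule sums_eq_rule) (auto simp: add_ac)
  also have "(\<lambda>k. 1 / (real k + 1 + x) + 1 / (real k + 1 - x) - 2 / (real k + 1)) =
     (\<lambda>k. 2 * (x\<^sup>2 * (1 / real (k + 1) / (real (k + 1) ^ 2 - x\<^sup>2))))"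
  proof
    fix k
    define N where "N = real k + 1"
    have "N - x \<noteq> 0" "N + x \<noteq> 0" "N \<noteq> 0"
      using x by (auto simp: N_def)
    moreover have "N\<^sup>2 - x\<^sup>2 = (N - x) * (N + x)"
      by (simp add: power2_eq_square algebra_simps)
    moreover have "real (k + 1) = N"
      by (simp add: N_def)
    ultimately show "1 / (real k + 1 + x) + 1 / (real k + 1 - x) - 2 / (real k + 1) =
      2 * (x\<^sup>2 * (1 / real (k + 1) / (real (k + 1) ^ 2 - x\<^sup>2)))"
      unfolding N_def[symmetric] by (simp add: divide_simps) (simp add: power2_eq_square algebra_simps)
  qed
  finally have pf: "(\<lambda>k. x\<^sup>2 * (1 / real (k + 1) / (real (k + 1) ^ 2 - x\<^sup>2))) sums ((R_fun x - 1 / x) / 2)"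
    by (auto dest: sums_divide[of _ _ 2])
  have "(\<lambda>n. (if n = 0 then 0 else zeta (2 * n + 1)) * (x\<^sup>2) ^ n) sums ((R_fun x - 1 / x) / 2)"
    by (rule sums_eq_rule[OF sums_partial_fractions_shifted[OF _ _ _ pf]])
      (use x in \<open>auto simp: zeta_def\<close>)
  from powser_scale[OF this, of 2] show ?thesis
    by (rule sums_eq_rule) auto
qed

text \<open>Without its pole, B is odd in \<open>x\<close>; division by \<open>x\<close> makes it a
  power series in \<open>x\<^sup>2\<close>.\<close>

lemma B_fun_powser:
  assumes x: "0 < x" "x < 1"
  shows "(\<lambda>n. 2 * eta (2 * n + 2) * (x\<^sup>2) ^ n) sums ((B_fun x - 1 / x) / x)"
proof -
  \<comment> \<open>The telescoping now alternates: the index shift flips the sign, so the sum of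
    two fractions becomes a difference.\<close>
  have "(\<lambda>k. (-1) ^ k * (1 / (real k + x)) - (-1) ^ Suc k * (1 / (real (Suc k) + x))) sums ((-1) ^ 0 * (1 / (real 0 + x)) - 0)"
  proof (intro telescope_sums')
    have "(\<lambda>k. 1 / (real k + x)) \<longlonglongrightarrow> 0" by real_asymp
    then show "(\<lambda>k. (-1) ^ k * (1 / (real k + x))) \<longlonglongrightarrow> 0"
      by (subst tendsto_rabs_zero_iff[symmetric]) (auto simp: abs_mult dest: tendsto_rabs_zero)
  qed
  from sums_diff[OF B_fun_sums[OF x] this]
  have "(\<lambda>k. (-1) ^ k * (1 / (real k + 1 - x) - 1 / (real k + 1 + x))) sums (B_fun x - 1 / x)"
    by (simp add: algebra_simps)
  also have "(\<lambda>k. (-1) ^ k * (1 / (real k + 1 - x) - 1 / (real k + 1 + x))) =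
     (\<lambda>k. 2 * x * ((-1) ^ k / (real (k + 1) ^ 2 - x\<^sup>2)))"
  proof
    fix k
    define N where "N = real k + 1"
    have "N - x \<noteq> 0" "N + x \<noteq> 0" "N \<noteq> 0"
      using x by (auto simp: N_def)
    moreover have "N\<^sup>2 - x\<^sup>2 = (N - x) * (N + x)"
      by (simp add: power2_eq_square algebra_simps)
    moreover have "real (k + 1) = N"
      by (simp add: N_def)
    ultimately show "(-1) ^ k * (1 / (real k + 1 - x) - 1 / (real k + 1 + x)) =
      2 * x * ((-1) ^ k / (real (k + 1) ^ 2 - x\<^sup>2))"
      unfolding N_def[symmetric] by (simp add: divide_simps)
  qed
  finally have pf: "(\<lambda>k. (-1) ^ k / (real (k + 1) ^ 2 - x\<^sup>2)) sums ((B_fun x - 1 / x) / (2 * x))"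
    using x by (auto dest: sums_divide[of _ _ "2 * x"])
  have "(\<lambda>n. eta (2 * n + 2) * (x\<^sup>2) ^ n) sums ((B_fun x - 1 / x) / (2 * x))"
    by (rule sums_eq_rule[OF sums_partial_fractions[OF _ _ _ pf]])
      (use x in \<open>auto simp: eta_def power_mult\<close>)
  from powser_scale[OF this, of 2] show ?thesis
    by (rule sums_eq_rule) (use x in \<open>auto simp: field_simps\<close>)
qed

text \<open>The poles of R and B cancel, leaving
  \<open>f = (1 + S - x\<^sup>2 * S) + x * (S - 1 - E)\<close> with \<open>S = R - 1 / x\<close> and
  \<open>E = (B - 1 / x) / x\<close>. Both are series in \<open>x\<^sup>2\<close>, so even and odd
  coefficients separate.\<close>

lemma f_fun_powser:
  assumes x: "0 < x" "x < 1"
  shows "(\<lambda>n. a_coeff n * x ^ n) sums f_fun x"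
proof -
  let ?s = "\<lambda>n. if n = 0 then 0 else 2 * zeta (2 * n + 1)"
  let ?S = "R_fun x - 1 / x"
  let ?E = "(B_fun x - 1 / x) / x"
  note S = R_fun_powser[OF x] and E = B_fun_powser[OF x]
  have one: "(\<lambda>n. (if n = 0 then 1 else 0) * (x\<^sup>2) ^ n) sums 1"
    using powser_sums_if[of 0 "x\<^sup>2"] by simp
  have even: "(\<lambda>n. (if n = 0 then 1 else 0) * (x\<^sup>2) ^ n + ?s n * (x\<^sup>2) ^ n -
      (if n = 0 then 0 else ?s (n - 1)) * (x\<^sup>2) ^ n) sums (1 + ?S - x\<^sup>2 * ?S)"
    by (intro sums_diff sums_add powser_shift S one)
  have odd: "(\<lambda>n. x * (?s n * (x\<^sup>2) ^ n - (if n = 0 then 1 else 0) * (x\<^sup>2) ^ n - 2 * eta (2 * n + 2) * (x\<^sup>2) ^ n))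
     sums (x * (?S - 1 - ?E))"
    by (intro sums_mult sums_diff S E one)
  \<comment> \<open>S has no constant term, which explains the exceptional \<open>a_coeff 2\<close>:
    the general formula would involve the divergent \<open>zeta 1\<close>.\<close>
  have a_even: "a_coeff (2 * n) = (if n = 0 then 1 else 0) + ?s n - (if n = 0 then 0 else ?s (n - 1))" for n
  proof -
    consider "n = 0" | "n = 1" | m where "n = Suc (Suc m)"
      by (metis One_nat_def not0_implies_Suc)
    then show ?thesis
      by cases (auto simp: a_coeff_def numeral_3_eq_3)
  qed
  have a_odd: "a_coeff (2 * n + 1) = ?s n - (if n = 0 then 1 else 0) - 2 * eta (2 * n + 2)" for n
  proof (cases "n = 0")
    case False
    then have "2 * n + 1 \<noteq> 2" "2 * n + 1 \<noteq> 1" "2 * n + 1 \<noteq> 0" "2 * n + 1 + 1 = 2 * n + 2"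
      by presburger+
    moreover have "(- 1 :: real) ^ (2 * n + 1) = - 1" by simp
    ultimately show ?thesis
      using False unfolding a_coeff_def by (simp only: if_False) simp
  qed (simp add: a_coeff_def numeral_2_eq_2[symmetric])
  have x_odd: "x ^ (2 * n + 1) = x * (x\<^sup>2) ^ n" for n
    by (simp add: power_mult)
  have "(\<lambda>n. if even n then a_coeff (2 * (n div 2)) * x ^ (2 * (n div 2)) else
         a_coeff (2 * ((n - 1) div 2) + 1) * x ^ (2 * ((n - 1) div 2) + 1))
      sums (x * (?S - 1 - ?E) + (1 + ?S - x\<^sup>2 * ?S))"
    using sums_if[OF odd even] unfolding a_even a_odd x_odd power_mult
    by (simp only: distrib_right distrib_left left_diff_distrib right_diff_distrib mult_ac)
  also have "(\<lambda>n. if even n then a_coeff (2 * (n div 2)) * x ^ (2 * (n div 2)) else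
         a_coeff (2 * ((n - 1) div 2) + 1) * x ^ (2 * ((n - 1) div 2) + 1)) = (\<lambda>n. a_coeff n * x ^ n)"
  proof
    fix n :: nat
    show "(if even n then a_coeff (2 * (n div 2)) * x ^ (2 * (n div 2)) else
         a_coeff (2 * ((n - 1) div 2) + 1) * x ^ (2 * ((n - 1) div 2) + 1)) = a_coeff n * x ^ n"
      by (cases "even n") (auto elim!: evenE oddE)
  qed
  also have "x * (?S - 1 - ?E) + (1 + ?S - x\<^sup>2 * ?S) = f_fun x"
    using x by (simp add: f_fun_def field_simps power2_eq_square)
  finally show ?thesis .
qed

section \<open>Numerical bounds\<close>

lemma zeta_3_bounds: "1.20205690 \<le> zeta 3" "zeta 3 \<le> 1.202056905"
proof -
  \<comment> \<open>\<open>G\<close> and \<open>H\<close> are partial sums of the inverse factorial expansion of \<open>\<Sum>k. 1 / (x + k) ^ 3\<close>.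
    They differ by \<open>O(x powr - 6)\<close>, so 24 explicit terms give eight digits.\<close>
  define G where "G x = 1 / (2 * x * (x - 1)) - 1 / (4 * (x - 2) * (x - 1) * x * (x + 1))" for x :: real
  define H where "H x = G x + 2 / (3 * (x - 3) * (x - 2) * (x - 1) * x * (x + 1) * (x + 2))" for x :: real
  have G_diff: "G x - G (x + 1) = 1 / x ^ 3 - 4 / (x ^ 3 * (x\<^sup>2 - 1) * (x\<^sup>2 - 4))" if "3 < x" for x
  proof -
    have fac: "x\<^sup>2 - 1 = (x - 1) * (x + 1)" "x\<^sup>2 - 4 = (x - 2) * (x + 2)"
      by (simp_all add: power2_eq_square algebra_simps)
    have "x \<noteq> 0" "x - 1 \<noteq> 0" "x + 1 \<noteq> 0" "x - 2 \<noteq> 0" "x + 2 \<noteq> 0"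
      using that by auto
    then show ?thesis
      unfolding G_def fac by (simp add: divide_simps) (simp add: power3_eq_cube algebra_simps)
  qed
  have H_diff: "H x - H (x + 1) = G x - G (x + 1) + 4 / (x * (x\<^sup>2 - 1) * (x\<^sup>2 - 4) * (x\<^sup>2 - 9))" if "3 < x" for x
  proof -
    have fac: "x\<^sup>2 - 1 = (x - 1) * (x + 1)" "x\<^sup>2 - 4 = (x - 2) * (x + 2)" "x\<^sup>2 - 9 = (x - 3) * (x + 3)"
      by (simp_all add: power2_eq_square algebra_simps)
    have "x \<noteq> 0" "x - 1 \<noteq> 0" "x + 1 \<noteq> 0" "x - 2 \<noteq> 0" "x + 2 \<noteq> 0" "x - 3 \<noteq> 0" "x + 3 \<noteq> 0"
      using that by auto
    then show ?thesis
      unfolding H_def fac by (simp add: divide_simps) (simp add: algebra_simps)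
  qed
  \<comment> \<open>\<open>G\<close> telescopes to slightly less than \<open>1 / x ^ 3\<close>. The
    correction in \<open>H\<close> has \<open>x\<^sup>2 - 9\<close> in place of a factor
    \<open>x\<^sup>2\<close> in the denominator of the error, so it overcompensates.\<close>
  have bounds: "G x - G (x + 1) \<le> 1 / x ^ 3" "1 / x ^ 3 \<le> H x - H (x + 1)" if "3 < x" for x
  proof -
    have "9 < x\<^sup>2"
      using power_strict_mono[OF that, of 2] by simp
    then have pos: "0 < x ^ 3 * (x\<^sup>2 - 1) * (x\<^sup>2 - 4)" "0 < x * (x\<^sup>2 - 1) * (x\<^sup>2 - 4) * (x\<^sup>2 - 9)"
      using that by (auto intro!: mult_pos_pos)
    have "x * (x\<^sup>2 - 1) * (x\<^sup>2 - 4) * (x\<^sup>2 - 9) \<le> x * (x\<^sup>2 - 1) * (x\<^sup>2 - 4) * x\<^sup>2"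
      using \<open>9 < x\<^sup>2\<close> that by (intro mult_left_mono) auto
    also have "\<dots> = x ^ 3 * (x\<^sup>2 - 1) * (x\<^sup>2 - 4)"
      by (simp add: power2_eq_square power3_eq_cube)
    finally have "4 / (x ^ 3 * (x\<^sup>2 - 1) * (x\<^sup>2 - 4)) \<le> 4 / (x * (x\<^sup>2 - 1) * (x\<^sup>2 - 4) * (x\<^sup>2 - 9))"
      by (rule divide_left_mono) (use mult_pos_pos[OF pos] in auto)
    moreover have "0 \<le> 4 / (x ^ 3 * (x\<^sup>2 - 1) * (x\<^sup>2 - 4))"
      using pos by simp
    ultimately show "G x - G (x + 1) \<le> 1 / x ^ 3" "1 / x ^ 3 \<le> H x - H (x + 1)"
      using that by (simp_all add: H_diff G_diff)
  qed
  have "(\<lambda>k. 1 / real (k + 24 + 1) ^ 3) sums (zeta 3 - (\<Sum>k<24. 1 / real (k + 1) ^ 3))"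
    by (rule sums_split_initial_segment[OF zeta_sums]) auto
  then have tail: "(\<lambda>k. 1 / (real k + 25) ^ 3) sums (zeta 3 - (\<Sum>k<24. 1 / real (k + 1) ^ 3))"
    by (simp add: add_ac)
  have "(\<lambda>k. G (real k + 25) - G (real (Suc k) + 25)) sums (G (real 0 + 25) - 0)"
    unfolding G_def by (rule telescope_sums') real_asymp
  then have G_sums: "(\<lambda>k. G (real k + 25) - G (real k + 25 + 1)) sums G 25"
    by (simp add: add_ac)
  have "G 25 \<le> zeta 3 - (\<Sum>k<24. 1 / real (k + 1) ^ 3)"
    by (rule sums_le[OF bounds(1) G_sums tail]) simp
  then have lower: "G 25 + (\<Sum>k<24. 1 / real (k + 1) ^ 3) \<le> zeta 3"
    by simp
  have "(\<lambda>k. H (real k + 25) - H (real (Suc k) + 25)) sums (H (real 0 + 25) - 0)"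
    unfolding H_def G_def by (rule telescope_sums') real_asymp
  then have H_sums: "(\<lambda>k. H (real k + 25) - H (real k + 25 + 1)) sums H 25"
    by (simp add: add_ac)
  have "zeta 3 - (\<Sum>k<24. 1 / real (k + 1) ^ 3) \<le> H 25"
    by (rule sums_le[OF bounds(2) tail H_sums]) simp
  then have upper: "zeta 3 \<le> H 25 + (\<Sum>k<24. 1 / real (k + 1) ^ 3)"
    by simp
  show "1.20205690 \<le> zeta 3"
    by (rule order.trans[OF _ lower]) (simp add: G_def lessThan_nat_numeral)
  show "zeta 3 \<le> 1.202056905"
    by (rule order.trans[OF upper]) (simp add: G_def H_def lessThan_nat_numeral)
qed

text \<open>The value is \<open>4 * ln 2 - pi + (35 * zeta 3 - pi ^ 3) / 8 - 1\<close>, where terms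
  of size up to 5 cancel to about 0.014210435. The lower bound leaves a margin of only 3.5e-8, hence
  the precision of the constants.\<close>

lemma b_coeff_0_1_bounds:
  "0.0142104 \<le> b_coeff 0 + b_coeff 1 - 1" "b_coeff 0 + b_coeff 1 - 1 < 0.0142105"
proof -
  have ln2: "0.69314718 \<le> ln (2::real)" "ln (2::real) \<le> 0.693147181"
    using ln_approx_bounds[of 2 9] by (simp_all add: lessThan_nat_numeral power_divide)
  have "3.141592653588 ^ 3 \<le> pi ^ 3" "pi ^ 3 \<le> 3.1415926535899 ^ 3"
    using pi_approx by (intro power_mono; simp)+
  with ln2 zeta_3_bounds pi_approx show "0.0142104 \<le> b_coeff 0 + b_coeff 1 - 1"
      "b_coeff 0 + b_coeff 1 - 1 < 0.0142105"
    by (simp_all add: b_coeff_def field_simps power3_eq_cube)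
qed

section \<open>Complete monotonicity\<close>

lemma b_coeff_neg:
  assumes n: "2 \<le> n"
  shows "b_coeff n < 0"
proof -
  define t where "t k = (real (2 * k + 1) ^ 2 - 5 + 4 * (-1) ^ k) / real (2 * k + 1) ^ (2 * n + 1)" for k :: nat
  have "(\<lambda>k. 1 / real (2 * k + 1) ^ (2 * n - 1) - 5 * (1 / real (2 * k + 1) ^ (2 * n + 1)) +
      4 * ((-1) ^ k / real (2 * k + 1) ^ (2 * n + 1)))
     sums (lambda (2 * n - 1) - 5 * lambda (2 * n + 1) + 4 * beta (2 * n + 1))"
    using n by (intro sums_add sums_diff sums_mult lambda_sums beta_sums) auto
  then have "t sums - b_coeff n"
  proof (rule sums_eq_rule)
    fix k
    have "2 * n + 1 = (2 * n - 1) + 2"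
      using n by simp
    then have "real (2 * k + 1) ^ (2 * n + 1) = real (2 * k + 1) ^ (2 * n - 1) * real (2 * k + 1) ^ 2"
      by (simp only: power_add)
    then have "1 / real (2 * k + 1) ^ (2 * n - 1) = real (2 * k + 1) ^ 2 / real (2 * k + 1) ^ (2 * n + 1)"
      by simp
    then show "1 / real (2 * k + 1) ^ (2 * n - 1) - 5 * (1 / real (2 * k + 1) ^ (2 * n + 1)) +
      4 * ((-1) ^ k / real (2 * k + 1) ^ (2 * n + 1)) = t k"
      unfolding t_def by (simp add: add_divide_distrib diff_divide_distrib)
  qed (use n in \<open>simp add: b_coeff_def\<close>)
  \<comment> \<open>The numerator of \<open>t k\<close> vanishes for \<open>k = 0\<close> and \<open>k = 1\<close>.\<close>
  moreover have "0 \<le> t k" for k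
  proof (cases "k = 0")
    case False
    then have "3 ^ 2 \<le> real (2 * k + 1) ^ 2"
      by (intro power_mono) auto
    moreover have "- 1 \<le> (- 1 :: real) ^ k"
      by (cases "even k") auto
    ultimately show ?thesis
      unfolding t_def by (intro divide_nonneg_nonneg) auto
  qed (simp add: t_def)
  \<comment> \<open>The index 2 gives the first nonzero numerator,
    \<open>25 - 5 + 4 = 24\<close>.\<close>
  moreover have "0 < t 2"
    by (simp add: t_def)
  ultimately show ?thesis
    using suminf_pos2[of t 2] by (auto simp: sums_iff)
qed

text \<open>Zeros at odd indices turn a series in \<open>y\<^sup>2\<close> into one in
  \<open>y\<close>, to which \<open>diffs\<close> applies.\<close>

lemma sums_even_powser:
  fixes b :: "nat \<Rightarrow> real"
  assumes "(\<lambda>n. b n * y ^ (2 * n)) sums s"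
  shows "(\<lambda>n. (if even n then b (n div 2) else 0) * y ^ n) sums s"
  using sums_if[OF sums_zero assms] by (rule sums_eq_rule) auto

section \<open>Functions given by power series in 1 - 2x\<close>

lemma half_powser_derivs:
  fixes \<phi> :: "real \<Rightarrow> real"
  assumes "\<And>x. 0 < x \<Longrightarrow> x < 1 \<Longrightarrow> (\<lambda>n. c n * (1 - 2 * x) ^ n) sums \<phi> x"
  shows "0 < x \<Longrightarrow> x < 1 \<Longrightarrow>
      (\<lambda>n. ((-2) ^ m * (diffs ^^ m) c n) * (1 - 2 * x) ^ n) sums (deriv ^^ m) \<phi> x"
    and "0 < x \<Longrightarrow> x < 1 \<Longrightarrow>
      ((deriv ^^ m) \<phi> has_real_derivative (deriv ^^ Suc m) \<phi> x) (at x)"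
proof -
  have c: "summable (\<lambda>n. c n * z ^ n)" if "\<bar>z\<bar> < 1" for z
    using assms[of "(1 - z) / 2"] that by (auto simp: sums_iff diff_divide_distrib)
  have U: "\<bar>1 + (-2) * x\<bar> < 1" if "x \<in> {0<..<1}" for x :: real
    using that by auto
  have \<phi>: "\<phi> x = (\<Sum>n. c n * (1 + (-2) * x) ^ n)" if "x \<in> {0<..<1}" for x
    using assms[of x] that by (auto simp: sums_iff)
  note * = higher_deriv_powser[where c = c and m = m and U = "{0<..<1}" and \<alpha> = 1 and \<beta> = "-2" and r = 1 and f = \<phi>,
      OF open_greaterThanLessThan U c \<phi>]
  show "((deriv ^^ m) \<phi> has_real_derivative (deriv ^^ Suc m) \<phi> x) (at x)" if "0 < x" "x < 1"
    by (rule *(2)) (use that in auto)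
  show "(\<lambda>n. ((-2) ^ m * (diffs ^^ m) c n) * (1 - 2 * x) ^ n) sums (deriv ^^ m) \<phi> x" if "0 < x" "x < 1"
  proof -
    have "(\<lambda>n. (diffs ^^ m) c n * (1 - 2 * x) ^ n) sums (\<Sum>n. (diffs ^^ m) c n * (1 - 2 * x) ^ n)"
      by (intro summable_sums *(3)[of x]) (use that in auto)
    from powser_scale[OF this, of "(-2) ^ m"] show ?thesis
      using *(1)[of x] that by simp
  qed
qed

lemma half_powser_derivs_half:
  fixes \<phi> :: "real \<Rightarrow> real"
  assumes "\<And>x. 0 < x \<Longrightarrow> x < 1 \<Longrightarrow> (\<lambda>n. c n * (1 - 2 * x) ^ n) sums \<phi> x"
  shows "(deriv ^^ m) \<phi> (1/2) = (-2) ^ m * (fact m * c m)"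
proof -
  have "(\<lambda>n. ((-2) ^ m * (diffs ^^ m) c n) * 0 ^ n) sums (deriv ^^ m) \<phi> (1/2)"
    using half_powser_derivs(1)[of c \<phi> "1/2" m, OF assms] by simp
  from sums_unique2[OF this powser_sums_zero] show ?thesis
    by (simp add: higher_diffs)
qed

lemma half_powser_smooth_on:
  fixes \<phi> :: "real \<Rightarrow> real"
  assumes "\<And>x. 0 < x \<Longrightarrow> x < 1 \<Longrightarrow> (\<lambda>n. c n * (1 - 2 * x) ^ n) sums \<phi> x" and "I \<subseteq> {0<..<1}"
  shows "smooth_on \<phi> I"
  unfolding smooth_on_def
proof (intro exI[of _ "{0<..<1}"] conjI allI)
  show "(deriv ^^ m) \<phi> differentiable_on {0<..<1}" for m
    unfolding differentiable_on_def
  proof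
    fix x :: real assume "x \<in> {0<..<1}"
    then have "((deriv ^^ m) \<phi> has_real_derivative (deriv ^^ Suc m) \<phi> x) (at x)"
      by (intro half_powser_derivs(2)[of c]) (use assms(1) in auto)
    then show "(deriv ^^ m) \<phi> differentiable (at x within {0<..<1})"
      using differentiableI differentiable_at_withinI has_field_derivative_imp_has_derivative by blast
  qed
qed (use assms in auto)

text \<open>Differentiating \<open>m\<close> times produces the sign \<open>(-1) ^ m\<close> and
  coefficients that stay nonnegative, while \<open>1 - 2 * x\<close> is positive left of 1/2.
  Strictness there needs one positive coefficient of index at least \<open>m\<close>; at 1/2 only
  \<open>c m\<close> survives, which determines the admissible \<open>M\<close>.\<close>

lemma half_powser_strictly_cm:
  fixes \<phi> :: "real \<Rightarrow> real"
  assumes \<phi>: "\<And>x. 0 < x \<Longrightarrow> x < 1 \<Longrightarrow> (\<lambda>n. c n * (1 - 2 * x) ^ n) sums \<phi> x"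
    and nonneg: "\<And>n. 0 \<le> c n" and inf: "\<And>m. \<exists>n\<ge>m. 0 < c n" and M: "\<And>m. m \<in> M \<Longrightarrow> 0 < c m"
  shows "strictly_cm_up_to_half \<phi> M"
proof -
  have S: "(\<lambda>n. (2 ^ m * (diffs ^^ m) c n) * (1 - 2 * x) ^ n) sums ((-1) ^ m * (deriv ^^ m) \<phi> x)"
    if "0 < x" "x < 1" for x m
    using powser_scale[OF half_powser_derivs(1)[of c \<phi>, OF \<phi> that, of m], of "(-1) ^ m"]
    by (rule sums_eq_rule) (simp_all add: mult.assoc[symmetric] flip: power_mult_distrib)
  have diffs_nonneg: "0 \<le> (diffs ^^ m) c n" for m n
    by (simp add: higher_diffs nonneg)
  have pos: "0 < (-1) ^ m * (deriv ^^ m) \<phi> x" if "0 < x" "x < 1/2" for x m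
  proof -
    obtain n where n: "m \<le> n" "0 < c n"
      using inf by blast
    have "0 < (\<Sum>n. (2 ^ m * (diffs ^^ m) c n) * (1 - 2 * x) ^ n)"
    proof (rule suminf_pos2)
      \<comment> \<open>After \<open>m\<close> applications of \<open>diffs\<close>, the coefficient
        \<open>c n\<close> sits at index \<open>n - m\<close>.\<close>
      show "0 < 2 ^ m * (diffs ^^ m) c (n - m) * (1 - 2 * x) ^ (n - m)"
        using n that by (auto intro!: mult_pos_pos simp: higher_diffs)
    qed (use S[of x m] that in \<open>auto simp: sums_iff diffs_nonneg\<close>)
    then show ?thesis
      using S[of x m] that by (simp add: sums_iff)
  qed
  have half: "(-1) ^ m * (deriv ^^ m) \<phi> (1/2) = 2 ^ m * (fact m * c m)" for m
  proof -
    have "(deriv ^^ m) \<phi> (1/2) = (-2) ^ m * (fact m * c m)"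
      by (rule half_powser_derivs_half[of c]) (rule \<phi>)
    moreover have "(-1) ^ m * (-2) ^ m = (2 ^ m :: real)"
      by (simp flip: power_mult_distrib)
    ultimately show ?thesis
      by (metis mult.assoc)
  qed
  show ?thesis
    unfolding strictly_cm_up_to_half_def strictly_completely_monotonic_on_def completely_monotonic_on_def
  proof (intro conjI ballI allI)
    show "smooth_on \<phi> {0<..<1/2}" "smooth_on \<phi> {0<..1/2}"
      using \<phi> by (auto intro!: half_powser_smooth_on[of c])
    show "0 < (-1) ^ m * (deriv ^^ m) \<phi> x" if "x \<in> {0<..<1/2}" for x m
      using pos that by auto
    show "0 \<le> (-1) ^ m * (deriv ^^ m) \<phi> x" if "x \<in> {0<..1/2}" for x m
    proof (cases "x = 1/2")
      case True
      then show ?thesis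
        unfolding True half by (simp add: nonneg)
    next
      case False
      then show ?thesis
        using pos[of x m] that by simp
    qed
    show "0 < (-1) ^ m * (deriv ^^ m) \<phi> (1/2)" if "m \<in> M" for m
      unfolding half using M[OF that] by simp
  qed
qed

definition even_b :: "nat \<Rightarrow> real" where
  "even_b n = (if even n then b_coeff (n div 2) else 0)"

lemma even_b_neg:
  assumes "3 \<le> n" "even n"
  shows "even_b n < 0"
proof -
  have "2 \<le> n div 2"
    using assms by presburger
  then show ?thesis
    using assms by (simp add: even_b_def b_coeff_neg)
qed

lemma even_b_nonpos: "3 \<le> n \<Longrightarrow> even_b n \<le> 0"
  using even_b_neg[of n] by (cases "even n") (simp_all add: even_b_def)

section \<open>Signs of the derivatives of f and F\<close>

lemma f_fun_half_sums:
  assumes "0 < x" "x < 1"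
  shows "(\<lambda>n. even_b n * (1 - 2 * x) ^ n) sums f_fun x"
  unfolding even_b_def by (intro sums_even_powser f_fun_half_powser assms)

lemma f_fun_derivs:
  assumes "0 < x" "x < 1"
  shows "(\<lambda>n. ((-2) ^ m * (diffs ^^ m) even_b n) * (1 - 2 * x) ^ n) sums (deriv ^^ m) f_fun x"
    and "((deriv ^^ m) f_fun has_real_derivative (deriv ^^ Suc m) f_fun x) (at x)"
  by (rule half_powser_derivs[of even_b, OF f_fun_half_sums assms]; assumption)+

lemma F_fun_eq: "F_fun x = b_coeff 0 + b_coeff 1 * (1 - 2 * x)\<^sup>2 - f_fun x"
  by (simp add: F_fun_def f_fun_def)

text \<open>F is the negated tail of the expansion of f beyond degree two, and that tail has only
  nonpositive coefficients.\<close>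

lemma F_fun_half_sums:
  assumes "0 < x" "x < 1"
  shows "(\<lambda>n. (if n \<ge> 3 then - even_b n else 0) * (1 - 2 * x) ^ n) sums F_fun x"
proof -
  have "(\<lambda>n. if n \<in> {..<3} then even_b n * (1 - 2 * x) ^ n else 0) sums (\<Sum>n\<in>{..<3}. even_b n * (1 - 2 * x) ^ n)"
    by (rule sums_If_finite_set) simp
  from sums_diff[OF this f_fun_half_sums[OF assms]] show ?thesis
    by (rule sums_eq_rule) (auto simp: F_fun_eq even_b_def numeral_3_eq_3 power2_eq_square)
qed

lemma F_fun_strictly_cm: "strictly_cm_up_to_half F_fun {m. even m \<and> m \<ge> 4}"
proof (rule half_powser_strictly_cm[OF F_fun_half_sums])
  fix n m :: nat
  show "0 \<le> (if n \<ge> 3 then - even_b n else 0)"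
    using even_b_nonpos[of n] by simp
  show "\<exists>n\<ge>m. 0 < (if n \<ge> 3 then - even_b n else 0)"
    using even_b_neg[of "2 * m + 4"] by (intro exI[of _ "2 * m + 4"]) auto
qed (auto simp: even_b_neg)

lemma F1_fun_half_sums:
  assumes "0 < x" "x < 1"
  shows "(\<lambda>k. - (2 ^ n * (diffs ^^ n) even_b k) * (1 - 2 * x) ^ k) sums F1_fun n x"
  using powser_scale[OF f_fun_derivs(1)[OF assms, of n], of "(-1) ^ (n + 1)"]
  by (rule sums_eq_rule) (simp_all add: F1_fun_def mult.assoc[symmetric] flip: power_mult_distrib)

text \<open>At least three differentiations leave only coefficients \<open>even_b\<close> of index 3
  or more, none of them positive. Agreement on (0, 1) suffices for \<open>\<phi>\<close>, so that
  \<open>- deriv (F1_fun 2)\<close> is covered too.\<close>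

lemma F1_fun_strictly_cm:
  assumes n: "3 \<le> n" and eq: "\<And>x. 0 < x \<Longrightarrow> x < 1 \<Longrightarrow> \<phi> x = F1_fun n x"
  shows "strictly_cm_up_to_half \<phi> {m. even (n + m)}"
proof (rule half_powser_strictly_cm)
  show "(\<lambda>k. - (2 ^ n * (diffs ^^ n) even_b k) * (1 - 2 * x) ^ k) sums \<phi> x" if "0 < x" "x < 1" for x
    using F1_fun_half_sums[OF that] eq[OF that] by simp
  show "0 \<le> - (2 ^ n * (diffs ^^ n) even_b k)" for k
    using even_b_nonpos[of "k + n"] n by (simp add: higher_diffs mult_le_0_iff divide_le_0_iff)
  have neg: "0 < - (2 ^ n * (diffs ^^ n) even_b k)" if "even (n + k)" for k
    using even_b_neg[of "k + n"] n that by (simp add: higher_diffs mult_less_0_iff divide_less_0_iff add.commute)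
  then show "0 < - (2 ^ n * (diffs ^^ n) even_b m)" if "m \<in> {m. even (n + m)}" for m
    using that by simp
  \<comment> \<open>One of \<open>m\<close> and \<open>Suc m\<close> has the parity of
    \<open>n\<close>.\<close>
  show "\<exists>k\<ge>m. 0 < - (2 ^ n * (diffs ^^ n) even_b k)" for m
    using neg[of "if even (n + m) then m else Suc m"]
    by (intro exI[of _ "if even (n + m) then m else Suc m"]) simp
qed

lemma minus_deriv_F1_fun_2:
  assumes "0 < x" "x < 1"
  shows "- deriv (F1_fun 2) x = F1_fun 3 x"
proof -
  have "((\<lambda>x. - (deriv ^^ 2) f_fun x) has_real_derivative - (deriv ^^ Suc 2) f_fun x) (at x)"
    by (intro DERIV_minus f_fun_derivs assms)
  moreover have "F1_fun 2 = (\<lambda>x. - (deriv ^^ 2) f_fun x)"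
    by (simp add: F1_fun_def fun_eq_iff)
  ultimately have "deriv (F1_fun 2) x = - (deriv ^^ Suc 2) f_fun x"
    by (simp only: DERIV_imp_deriv)
  then show ?thesis
    by (simp add: F1_fun_def numeral_3_eq_3 numeral_2_eq_2)
qed

section \<open>Values at 1/2 and limits at 0\<close>

lemma f_fun_derivs_half: "(deriv ^^ n) f_fun (1/2) = (-2) ^ n * (fact n * even_b n)"
  by (rule half_powser_derivs_half[of even_b]) (rule f_fun_half_sums)

text \<open>On (0, 1) the derivative agrees with a power series about 0. That series is continuous
  at 0, so its constant term is the limit from the right.\<close>

lemma f_fun_derivs_at_0: "((deriv ^^ n) f_fun \<longlongrightarrow> fact n * a_coeff n) (at_right 0)"
proof -
  have summ: "summable (\<lambda>n. a_coeff n * z ^ n)" if "\<bar>z\<bar> < 1" for z :: real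
  proof -
    \<comment> \<open>The expansion is known for positive arguments only; a positive
      \<open>K\<close> beyond the absolute value of \<open>z\<close> carries summability over to all
      \<open>z\<close>.\<close>
    obtain K where K: "\<bar>z\<bar> < K" "K < 1"
      using dense[OF \<open>\<bar>z\<bar> < 1\<close>] by blast
    then have "summable (\<lambda>n. a_coeff n * K ^ n)"
      by (intro sums_summable[OF f_fun_powser]) auto
    then show ?thesis
      by (rule powser_inside) (use K in auto)
  qed
  have U: "\<bar>0 + 1 * x\<bar> < 1" if "x \<in> {0<..<1}" for x :: real
    using that by auto
  have f: "f_fun x = (\<Sum>k. a_coeff k * (0 + 1 * x) ^ k)" if "x \<in> {0<..<1}" for x
    using f_fun_powser[of x] that by (simp add: sums_iff)
  note * = higher_deriv_powser[where c = a_coeff and m = n and U = "{0<..<1}" and \<alpha> = 0 and \<beta> = 1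
      and r = 1 and f = f_fun, OF open_greaterThanLessThan U summ f]
  define h where "h z = (\<Sum>k. (diffs ^^ n) a_coeff k * z ^ k)" for z :: real
  have "(deriv ^^ n) f_fun x = h x" if "0 < x" "x < 1" for x
    using *(1)[of x] that by (simp add: h_def)
  then have ev: "eventually (\<lambda>x. h x = (deriv ^^ n) f_fun x) (at_right 0)"
    using eventually_at_right_real[of 0 "1::real"] by (auto elim!: eventually_mono)
  have "summable (\<lambda>k. (diffs ^^ n) a_coeff k * (1/2) ^ k)"
    by (rule *(3)[of "1/2"]) auto
  then have "isCont h 0"
    unfolding h_def [abs_def] by (rule isCont_powser) auto
  then have "(h \<longlongrightarrow> h 0) (at_right 0)"
    by (simp add: isCont_def filterlim_at_split)
  moreover have "h 0 = fact n * a_coeff n"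
    unfolding h_def powser_zero by (simp add: higher_diffs)
  ultimately show ?thesis
    using Lim_transform_eventually[OF _ ev] by simp
qed

lemma F1_fun_at_0: "(F1_fun n \<longlongrightarrow> (-1) ^ (n + 1) * fact n * a_coeff n) (at_right 0)"
  unfolding F1_fun_def [abs_def] mult.assoc by (intro tendsto_mult_left f_fun_derivs_at_0)

lemma f_fun_at_0: "(f_fun \<longlongrightarrow> 1) (at_right 0)"
  using f_fun_derivs_at_0[of 0] by (simp add: a_coeff_def)

lemma F_fun_at_0: "(F_fun \<longlongrightarrow> b_coeff 0 + b_coeff 1 - 1) (at_right 0)"
proof -
  have "((\<lambda>x. b_coeff 0 + b_coeff 1 * (1 - 2 * x)\<^sup>2 - f_fun x) \<longlongrightarrow> b_coeff 0 + b_coeff 1 * (1 - 2 * 0)\<^sup>2 - 1) (at_right 0)"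
    by (intro tendsto_intros f_fun_at_0)
  then show ?thesis
    by (simp add: F_fun_eq [abs_def])
qed

section \<open>Shape of f and bounds for R\<close>

text \<open>The left endpoint is missing, so L is a supremum that is not attained; the intermediate
  value theorem reaches everything below it.\<close>

lemma antimono_limit_image:
  fixes g :: "real \<Rightarrow> real"
  assumes h: "0 < h" and cont: "continuous_on {0<..h} g"
    and anti: "\<And>x y. 0 < x \<Longrightarrow> x < y \<Longrightarrow> y \<le> h \<Longrightarrow> g y < g x"
    and lim: "(g \<longlongrightarrow> L) (at_right 0)"
  shows "g ` {0<..h} = {g h..<L}"
proof (intro equalityI subsetI)
  fix v assume "v \<in> g ` {0<..h}"
  then obtain x where x: "0 < x" "x \<le> h" "v = g x" by auto
  \<comment> \<open>The intermediate point \<open>x / 2\<close> makes the bound strict: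
    \<open>g x < g (x / 2) \<le> L\<close>.\<close>
  have "eventually (\<lambda>t. g (x / 2) \<le> g t) (at_right 0)"
    using eventually_at_right_real[of 0 "x / 2"] x
    by (auto elim!: eventually_mono intro!: less_imp_le anti)
  then have "g (x / 2) \<le> L"
    by (intro tendsto_lowerbound[OF lim]) auto
  moreover have "g x < g (x / 2)"
    using x by (intro anti) auto
  moreover have "g h \<le> g x"
    using anti[of x h] x by (cases "x = h") auto
  ultimately show "v \<in> {g h..<L}"
    using x by auto
next
  fix v assume v: "v \<in> {g h..<L}"
  have "eventually (\<lambda>t. v < g t \<and> t \<in> {0<..<h}) (at_right 0)"
    using order_tendstoD(1)[OF lim, of v] eventually_at_right_real[OF h] v by (auto intro: eventually_conj)
  then obtain t where t: "v < g t" "0 < t" "t < h"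
    using eventually_happens'[OF trivial_limit_at_right_real] by fastforce
  have "\<exists>x\<ge>t. x \<le> h \<and> g x = v"
    using t v by (intro IVT2' continuous_on_subset[OF cont]) auto
  then show "v \<in> g ` {0<..h}"
    using t by force
qed

text \<open>This is strict convexity with a limit in place of the value at 0. Were the difference
  \<open>\<phi>\<close> from the secant nonnegative at \<open>x\<close>, the mean value theorem
  would give a slope at most 0 to the right of \<open>x\<close>, hence negative slopes up to
  \<open>x\<close>; falling from its limit 0, \<open>\<phi>\<close> would be negative at
  \<open>x\<close>.\<close>

lemma below_secant:
  fixes g g' :: "real \<Rightarrow> real"
  assumes deriv: "\<And>x. 0 < x \<Longrightarrow> x \<le> h \<Longrightarrow> (g has_real_derivative g' x) (at x)"
    and mono: "\<And>x y. 0 < x \<Longrightarrow> x < y \<Longrightarrow> y \<le> h \<Longrightarrow> g' x < g' y"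
    and lim: "(g \<longlongrightarrow> L) (at_right 0)" and x: "0 < x" "x < h"
  shows "g x < L + (g h - L) * (x / h)"
proof (rule ccontr)
  define \<phi> where "\<phi> t = g t - (L + (g h - L) * (t / h))" for t
  define \<phi>' where "\<phi>' t = g' t - (g h - L) / h" for t
  assume "\<not> g x < L + (g h - L) * (x / h)"
  then have ge: "0 \<le> \<phi> x" by (simp add: \<phi>_def)
  have \<phi>_deriv: "(\<phi> has_real_derivative \<phi>' t) (at t)" if "0 < t" "t \<le> h" for t
    unfolding \<phi>_def [abs_def] \<phi>'_def using deriv[OF that] that by (auto intro!: derivative_eq_intros)
  obtain z where z: "x < z" "z < h" "\<phi> h - \<phi> x = (h - x) * \<phi>' z"
    using MVT2[of x h \<phi> \<phi>'] \<phi>_deriv x by auto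
  have "\<phi> h = 0"
    using x by (simp add: \<phi>_def)
  then have "(h - x) * \<phi>' z \<le> 0"
    using z ge by simp
  then have "\<phi>' z \<le> 0"
    using x by (simp add: mult_le_0_iff)
  have neg: "\<phi>' t < 0" if "0 < t" "t \<le> x" for t
    using mono[of t z] that z \<open>\<phi>' z \<le> 0\<close> by (simp add: \<phi>'_def)
  have "\<phi> ` {0<..x} = {\<phi> x..<0}"
  proof (rule antimono_limit_image)
    show "continuous_on {0<..x} \<phi>"
      using x by (intro continuous_at_imp_continuous_on ballI DERIV_isCont[OF \<phi>_deriv]) auto
    show "\<phi> b < \<phi> a" if "0 < a" "a < b" "b \<le> x" for a b
      using that x \<phi>_deriv neg by (intro DERIV_neg_imp_decreasing[of a b \<phi>]) force+
    have "(\<phi> \<longlongrightarrow> L - (L + (g h - L) * (0 / h))) (at_right 0)"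
      unfolding \<phi>_def [abs_def] using x by (intro tendsto_intros lim) auto
    then show "(\<phi> \<longlongrightarrow> 0) (at_right 0)" by simp
  qed (use x in auto)
  then have "\<phi> x < 0"
    using x by (metis atLeastLessThan_iff greaterThanAtMost_iff imageI order_refl)
  with ge show False by simp
qed

section \<open>Monotonicity and convexity of f and its derivative\<close>

lemma deriv3_f_fun_pos:
  assumes "0 < x" "x < 1/2"
  shows "0 < (deriv ^^ 3) f_fun x"
proof -
  have "strictly_cm_up_to_half (F1_fun 3) {m. even (3 + m)}"
    by (rule F1_fun_strictly_cm) auto
  then have "0 < (-1) ^ 0 * (deriv ^^ 0) (F1_fun 3) x"
    unfolding strictly_cm_up_to_half_def strictly_completely_monotonic_on_def using assms
    by (metis greaterThanLessThan_iff)
  then show ?thesis by (simp add: F1_fun_def)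
qed

lemma isCont_deriv_f_fun:
  assumes "0 < x" "x < 1"
  shows "isCont ((deriv ^^ m) f_fun) x"
  using f_fun_derivs(2)[OF assms] by (rule DERIV_isCont)

lemma zeta_3_pos: "0 < zeta 3"
  using zeta_3_bounds by simp

lemma deriv2_f_fun_mono:
  assumes "0 < x" "x < y" "y \<le> 1/2"
  shows "(deriv ^^ 2) f_fun x < (deriv ^^ 2) f_fun y"
proof (rule DERIV_pos_imp_increasing_open[OF \<open>x < y\<close>])
  \<comment> \<open>Only interior points are used, since the third derivative vanishes at
    1/2.\<close>
  show "\<exists>D. ((deriv ^^ 2) f_fun has_real_derivative D) (at t) \<and> 0 < D" if "x < t" "t < y" for t
    using f_fun_derivs(2)[of t 2] deriv3_f_fun_pos[of t] that assms
    by (intro exI[of _ "(deriv ^^ Suc 2) f_fun t"]) (auto simp: numeral_3_eq_3 numeral_2_eq_2)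
  show "continuous_on {x..y} ((deriv ^^ 2) f_fun)"
    using assms by (intro continuous_at_imp_continuous_on ballI isCont_deriv_f_fun) auto
qed

lemma deriv2_f_fun_pos:
  assumes "0 < x" "x \<le> 1/2"
  shows "0 < (deriv ^^ 2) f_fun x"
proof -
  have "eventually (\<lambda>t. (deriv ^^ 2) f_fun t \<le> (deriv ^^ 2) f_fun x) (at_right 0)"
    using eventually_at_right_real[OF assms(1)] assms
    by (auto elim!: eventually_mono intro!: less_imp_le[OF deriv2_f_fun_mono])
  then have "fact 2 * a_coeff 2 \<le> (deriv ^^ 2) f_fun x"
    by (intro tendsto_upperbound[OF f_fun_derivs_at_0]) auto
  then show ?thesis
    using zeta_3_pos by (simp add: a_coeff_def)
qed

lemma deriv_f_fun:
  assumes "0 < x" "x < 1"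
  shows "(f_fun has_real_derivative deriv f_fun x) (at x)"
    and "(deriv f_fun has_real_derivative (deriv ^^ 2) f_fun x) (at x)"
    and "((deriv ^^ 2) f_fun has_real_derivative (deriv ^^ 3) f_fun x) (at x)"
  using f_fun_derivs(2)[OF assms, of 0] f_fun_derivs(2)[OF assms, of 1] f_fun_derivs(2)[OF assms, of 2]
  by (simp_all add: numeral_2_eq_2 numeral_3_eq_3)

lemma deriv_f_fun_mono:
  assumes "0 < x" "x < y" "y \<le> 1/2"
  shows "deriv f_fun x < deriv f_fun y"
proof (rule DERIV_pos_imp_increasing[OF \<open>x < y\<close>])
  show "\<exists>D. (deriv f_fun has_real_derivative D) (at t) \<and> 0 < D" if "x \<le> t" "t \<le> y" for t
    using deriv_f_fun(2)[of t] deriv2_f_fun_pos[of t] that assms by auto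
qed

lemma deriv_f_fun_half: "deriv f_fun (1/2) = 0"
  using f_fun_derivs_half[of 1] by (simp add: even_b_def)

lemma f_fun_antimono:
  assumes "0 < x" "x < y" "y \<le> 1/2"
  shows "f_fun y < f_fun x"
proof (rule DERIV_neg_imp_decreasing_open[OF \<open>x < y\<close>])
  show "\<exists>D. (f_fun has_real_derivative D) (at t) \<and> D < 0" if "x < t" "t < y" for t
    \<comment> \<open>The increasing derivative reaches 0 at 1/2, so it is negative before.\<close>
    using deriv_f_fun(1)[of t] deriv_f_fun_mono[of t "1/2"] that assms by (auto simp: deriv_f_fun_half)
  show "continuous_on {x..y} f_fun"
    using isCont_deriv_f_fun[of _ 0] assms by (intro continuous_at_imp_continuous_on) auto
qed

lemma f_fun_half: "f_fun (1/2) = b_coeff 0"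
  using f_fun_derivs_half[of 0] by (simp add: even_b_def)

lemma f_fun_image: "f_fun ` {0<..1/2} = {b_coeff 0..<1}"
  unfolding f_fun_half[symmetric]
proof (rule antimono_limit_image)
  show "continuous_on {0<..1/2} f_fun"
    using isCont_deriv_f_fun[of _ 0] by (intro continuous_at_imp_continuous_on) auto
qed (auto intro: f_fun_antimono f_fun_at_0)

lemma deriv_f_fun_image: "deriv f_fun ` {0<..1/2} = {a_coeff 1<..0}"
proof -
  \<comment> \<open>Negation makes the increasing derivative fit
    \<open>antimono_limit_image\<close>.\<close>
  have "(\<lambda>x. - deriv f_fun x) ` {0<..1/2} = {- deriv f_fun (1/2)..<- a_coeff 1}"
  proof (rule antimono_limit_image)
    show "continuous_on {0<..1/2} (\<lambda>x. - deriv f_fun x)"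
      using isCont_deriv_f_fun[of _ 1]
      by (intro continuous_at_imp_continuous_on ballI continuous_minus) auto
    show "((\<lambda>x. - deriv f_fun x) \<longlongrightarrow> - a_coeff 1) (at_right 0)"
      using tendsto_minus[OF f_fun_derivs_at_0[of 1]] by simp
  qed (auto intro: deriv_f_fun_mono)
  then have "uminus ` (\<lambda>x. - deriv f_fun x) ` {0<..1/2} = uminus ` {0..<- a_coeff 1}"
    by (simp add: deriv_f_fun_half)
  then show ?thesis
    by (simp add: image_image)
qed

lemma f_fun_convex: "convex_on {0<..1/2} f_fun"
  by (rule f''_ge0_imp_convex[where f' = "deriv f_fun" and f'' = "(deriv ^^ 2) f_fun"])
    (auto intro: deriv_f_fun less_imp_le[OF deriv2_f_fun_pos])

lemma deriv_f_fun_convex: "convex_on {0<..1/2} (deriv f_fun)"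
proof (rule f''_ge0_imp_convex[where f' = "(deriv ^^ 2) f_fun" and f'' = "(deriv ^^ 3) f_fun"])
  show "0 \<le> (deriv ^^ 3) f_fun x" if "x \<in> {0<..1/2}" for x
  proof (cases "x = 1/2")
    case True
    show ?thesis
      unfolding True f_fun_derivs_half by (simp add: even_b_def)
  next
    case False
    then show ?thesis
      using deriv3_f_fun_pos[of x] that by simp
  qed
qed (auto intro: deriv_f_fun)

section \<open>Secants of f and F\<close>

lemma F_fun_half: "F_fun (1/2) = 0"
  by (simp add: F_fun_eq f_fun_half)

lemma F_fun_pos:
  assumes "0 < x" "x < 1/2"
  shows "0 < (deriv ^^ m) F_fun x * (-1) ^ m"
  using F_fun_strictly_cm assms
  by (auto simp: strictly_cm_up_to_half_def strictly_completely_monotonic_on_def mult.commute)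

lemma F_fun_derivs:
  assumes "0 < x" "x < 1"
  shows "((deriv ^^ m) F_fun has_real_derivative (deriv ^^ Suc m) F_fun x) (at x)"
  by (rule half_powser_derivs(2)[OF F_fun_half_sums assms])

text \<open>The secant runs from the limit 1 at 0 to \<open>b_coeff 0\<close> at 1/2; its slope
  supplies the constant entry of \<open>Q_fun\<close>.\<close>

lemma f_fun_below_secant:
  assumes "0 < x" "x < 1/2"
  shows "f_fun x < b_coeff 0 + (1 - 2 * x) * (1 - b_coeff 0)"
proof -
  have "f_fun x < 1 + (f_fun (1/2) - 1) * (x / (1/2))"
    by (rule below_secant[where g' = "deriv f_fun"])
       (use assms in \<open>auto intro: deriv_f_fun deriv_f_fun_mono f_fun_at_0\<close>)
  then show ?thesis
    by (simp add: f_fun_half algebra_simps)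
qed

text \<open>The secant runs from the limit of F at 0 to the value 0 at 1/2. Solved for f, this is
  the nonconstant entry of \<open>P_fun\<close>.\<close>

lemma F_fun_below_secant:
  assumes x: "0 < x" "x < 1/2"
  shows "F_fun x < (1 - 2 * x) * (b_coeff 0 + b_coeff 1 - 1)"
proof -
  have D: "(F_fun has_real_derivative deriv F_fun t) (at t)"
      "(deriv F_fun has_real_derivative (deriv ^^ 2) F_fun t) (at t)" if "0 < t" "t < 1" for t
    using F_fun_derivs[OF that, of 0] F_fun_derivs[OF that, of 1]
    by (simp_all add: numeral_2_eq_2)
  have "F_fun x < (b_coeff 0 + b_coeff 1 - 1) + (F_fun (1/2) - (b_coeff 0 + b_coeff 1 - 1)) * (x / (1/2))"
  proof (rule below_secant[where g' = "deriv F_fun"])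
    show "deriv F_fun s < deriv F_fun t" if "0 < s" "s < t" "t \<le> 1/2" for s t
    proof (rule DERIV_pos_imp_increasing_open[OF \<open>s < t\<close>])
      \<comment> \<open>The second derivative of F vanishes at 1/2, so positivity is asked for in
        the interior only.\<close>
      show "\<exists>D. (deriv F_fun has_real_derivative D) (at u) \<and> 0 < D" if "s < u" "u < t" for u
        using D(2)[of u] F_fun_pos[of u 2] that \<open>0 < s\<close> \<open>t \<le> 1/2\<close> by auto
      show "continuous_on {s..t} (deriv F_fun)"
        using that by (intro continuous_at_imp_continuous_on ballI DERIV_isCont[OF D(2)]) auto
    qed
  qed (use x D F_fun_at_0 in auto)
  then show ?thesis
    by (simp add: F_fun_half algebra_simps)
qed

text \<open>Solving the definition of f for R reduces everything to four bounds on f: its minimum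
  and the secant of F give the entries of \<open>P_fun\<close>, the secant of f and the positivity
  of F those of \<open>Q_fun\<close>. All are strict left of 1/2, where the factor
  \<open>1 - 2 * x\<close> has not yet vanished.\<close>

lemma R_fun_bounds:
  fixes x :: real
  assumes x: "x \<in> {0<..1/2}"
  defines "lo \<equiv> (b_coeff 0 + (1 - 2 * x) * P_fun x + B_fun x) / (1 + x * (1 - x))"
    and "hi \<equiv> (b_coeff 0 + (1 - 2 * x) * Q_fun x + B_fun x) / (1 + x * (1 - x))"
  shows "lo \<le> R_fun x \<and> R_fun x \<le> hi \<and> (lo = R_fun x \<longleftrightarrow> x = 1/2) \<and> (R_fun x = hi \<longleftrightarrow> x = 1/2)"
proof -
  have d: "0 < 1 + x * (1 - x)"
    using x by (intro add_pos_nonneg) auto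
  have R: "R_fun x = (f_fun x + B_fun x) / (1 + x * (1 - x))"
    using d by (simp add: f_fun_def)
  show ?thesis
  proof (cases "x = 1/2")
    case True
    then have eq: "lo = R_fun x" "hi = R_fun x"
      unfolding lo_def hi_def R by (simp_all only: True f_fun_half) simp_all
    show ?thesis
      unfolding eq using True by blast
  next
    case False
    then have x': "0 < x" "x < 1/2" using x by auto
    have "b_coeff 0 < f_fun x"
      using f_fun_antimono[OF x'] by (simp add: f_fun_half)
    moreover have "b_coeff 0 + (1 - 2 * x) * (1 - b_coeff 0 - b_coeff 1 + b_coeff 1 * (1 - 2 * x)) < f_fun x"
      using F_fun_below_secant[OF x'] by (simp add: F_fun_eq power2_eq_square algebra_simps)
    ultimately have "b_coeff 0 + (1 - 2 * x) * P_fun x < f_fun x"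
      by (auto simp: P_fun_def max_def)
    then have "lo < R_fun x"
      unfolding lo_def R using d by (intro divide_strict_right_mono) auto
    have "f_fun x < b_coeff 0 + (1 - 2 * x) * (b_coeff 1 * (1 - 2 * x))"
      using F_fun_pos[OF x', of 0] by (simp add: F_fun_eq power2_eq_square algebra_simps)
    with f_fun_below_secant[OF x'] have "f_fun x < b_coeff 0 + (1 - 2 * x) * Q_fun x"
      by (auto simp: Q_fun_def min_def)
    then have "R_fun x < hi"
      unfolding hi_def R using d by (intro divide_strict_right_mono) auto
    with \<open>lo < R_fun x\<close> False show ?thesis by auto
  qed
qed

theorem theorem1p1:
  shows
    "(\<forall>x\<in>{0<..1/2}. (\<lambda>n. a_coeff n * x ^ n) sums f_fun x \<and>
                      (\<lambda>n. b_coeff n * (1 - 2 * x) ^ (2 * n)) sums f_fun x) \<and>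
     (strict_antimono_on {0<..1/2} f_fun \<and>
      convex_on {0<..1/2} f_fun \<and>
      f_fun ` {0<..1/2} = {b_coeff 0..<1}) \<and>
     (f_fun differentiable_on {0<..<1} \<and>
      strict_mono_on {0<..1/2} (deriv f_fun) \<and>
      convex_on {0<..1/2} (deriv f_fun) \<and>
      deriv f_fun ` {0<..1/2} = {a_coeff 1<..0}) \<and>
     (strictly_cm_up_to_half F_fun {m. even m \<and> m \<ge> 4} \<and>
      (F_fun \<longlongrightarrow> b_coeff 0 + b_coeff 1 - 1) (at_right 0) \<and>
      0.0142104 \<le> b_coeff 0 + b_coeff 1 - 1 \<and>
      b_coeff 0 + b_coeff 1 - 1 < 0.0142105 \<and>
      F_fun (1/2) = 0) \<and>
     (\<forall>n\<ge>3. strictly_cm_up_to_half (F1_fun n) {m. even (n + m)}) \<and>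
     (smooth_on (F1_fun 2) {0<..1/2} \<and>
      strictly_cm_up_to_half (\<lambda>x. - deriv (F1_fun 2) x) {m. odd m}) \<and>
     (\<forall>n\<ge>2. (F1_fun n \<longlongrightarrow> (-1) ^ (n + 1) * fact n * a_coeff n) (at_right 0) \<and>
             (odd n \<longrightarrow> F1_fun n (1/2) = 0) \<and>
             (even n \<longrightarrow> F1_fun n (1/2) = - (2 ^ n) * fact n * b_coeff (n div 2))) \<and>
     (\<forall>x\<in>{0<..1/2}.
        (b_coeff 0 + (1 - 2 * x) * P_fun x + B_fun x) / (1 + x * (1 - x)) \<le> R_fun x \<and>
        R_fun x \<le> (b_coeff 0 + (1 - 2 * x) * Q_fun x + B_fun x) / (1 + x * (1 - x)) \<and>
        ((b_coeff 0 + (1 - 2 * x) * P_fun x + B_fun x) / (1 + x * (1 - x)) = R_fun x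
           \<longleftrightarrow> x = 1/2) \<and>
        (R_fun x = (b_coeff 0 + (1 - 2 * x) * Q_fun x + B_fun x) / (1 + x * (1 - x))
           \<longleftrightarrow> x = 1/2))"
proof (intro conjI)
  show "\<forall>x\<in>{0<..1/2}. (\<lambda>n. a_coeff n * x ^ n) sums f_fun x \<and>
      (\<lambda>n. b_coeff n * (1 - 2 * x) ^ (2 * n)) sums f_fun x"
    by (auto intro: f_fun_powser f_fun_half_powser)
  show "strict_antimono_on {0<..1/2} f_fun"
    by (auto simp: monotone_on_def intro: f_fun_antimono)
  show "strict_mono_on {0<..1/2} (deriv f_fun)"
    by (auto simp: monotone_on_def intro: deriv_f_fun_mono)
  show "f_fun differentiable_on {0<..<1}"
    using deriv_f_fun(1) unfolding differentiable_on_def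
    by (meson differentiableI differentiable_at_withinI greaterThanLessThan_iff has_field_derivative_imp_has_derivative)
  show "\<forall>n\<ge>3. strictly_cm_up_to_half (F1_fun n) {m. even (n + m)}"
    by (intro allI impI F1_fun_strictly_cm) auto
  show "smooth_on (F1_fun 2) {0<..1/2}"
    by (rule half_powser_smooth_on[OF F1_fun_half_sums]) auto
  have "strictly_cm_up_to_half (\<lambda>x. - deriv (F1_fun 2) x) {m. even (3 + m)}"
    by (rule F1_fun_strictly_cm) (auto intro: minus_deriv_F1_fun_2)
  moreover have "{m. even (3 + m)} = {m :: nat. odd m}"
    by auto
  ultimately show "strictly_cm_up_to_half (\<lambda>x. - deriv (F1_fun 2) x) {m. odd m}"
    by simp
  show "\<forall>n\<ge>2. (F1_fun n \<longlongrightarrow> (-1) ^ (n + 1) * fact n * a_coeff n) (at_right 0) \<and>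
      (odd n \<longrightarrow> F1_fun n (1/2) = 0) \<and>
      (even n \<longrightarrow> F1_fun n (1/2) = - (2 ^ n) * fact n * b_coeff (n div 2))"
    using F1_fun_at_0 by (auto simp: F1_fun_def f_fun_derivs_half even_b_def)
qed (use R_fun_bounds b_coeff_0_1_bounds f_fun_convex f_fun_image deriv_f_fun_convex deriv_f_fun_image
      F_fun_strictly_cm F_fun_at_0 F_fun_half in \<open>auto\<close>)

end
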